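(* The prioritized multi-criteria 2-disjoint shortest paths problem in an undirected graph can be solved in polynomial time, in both its node-disjoint and edge-disjoint versions. That is, there is a polynomial-time algorithm that, given an undirected graph $G=(V,E)$ in which each edge $e$ carries a vector $\bar w(e)=(w_1(e),\dots,w_q(e))$ of positive integer weights, and two nodes $s,t\in V$, finds two $s$–$t$ paths that are node-disjoint except at $s$ and $t$ (respectively, edge-disjoint), each of which is a shortest $s$–$t$ path with respect to the prioritized (lexicographic) order of criteria, if such a pair exists.
   Context: For a path $P$ and $i\in\{1,\dots,q\}$, $c_i(P)=\sum_{e\in P}w_i(e)$. Criteria are prioritized: $P$ is shorter than $P'$ if $(c_1(P),\dots,c_q(P))$ is lexicographically smaller than $(c_1(P'),\dots,c_q(P'))$; a shortest $s$–$t$ path is one minimal in this order among all $s$–$t$ paths. Polynomial time means polynomial in $|V|$, $|E|$, $q$ and the bit lengths of the weights. *)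

theory Defs
  imports "HOL-Computational_Algebra.Polynomial"
begin

section \<open>Prioritized multi-criteria disjoint shortest paths\<close>

record 'v mc_instance =
  nodes :: "'v set"
  edges :: "'v set set"
  criteria :: nat
  weight :: "'v set \<Rightarrow> nat \<Rightarrow> nat"
  source :: 'v
  target :: 'v

text \<open>The criteria are numbered \<open>1, \<dots>, q\<close> with \<open>q = criteria I\<close>; \<open>weight I e i\<close> is \<open>w\<^sub>i(e)\<close>.\<close>

definition valid_instance :: "'v mc_instance \<Rightarrow> bool" where
  "valid_instance I \<longleftrightarrow>
     finite (nodes I) \<and>
     (\<forall>e\<in>edges I. \<exists>u\<in>nodes I. \<exists>v\<in>nodes I. u \<noteq> v \<and> e = {u, v}) \<and>
     1 \<le> criteria I \<and>
     (\<forall>e\<in>edges I. \<forall>i\<in>{1..criteria I}. 0 < weight I e i) \<and>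
     source I \<in> nodes I \<and> target I \<in> nodes I"

text \<open>A path is the list of its nodes; since the graph is simple, this determines its edges.\<close>

definition st_path :: "'v mc_instance \<Rightarrow> 'v list \<Rightarrow> bool" where
  "st_path I P \<longleftrightarrow>
     P \<noteq> [] \<and> hd P = source I \<and> last P = target I \<and>
     distinct P \<and> set P \<subseteq> nodes I \<and> successively (\<lambda>u v. {u, v} \<in> edges I) P"

definition path_edges :: "'v list \<Rightarrow> 'v set set" where
  "path_edges P = (\<lambda>(u, v). {u, v}) ` set (zip P (tl P))"

definition path_cost :: "'v mc_instance \<Rightarrow> nat \<Rightarrow> 'v list \<Rightarrow> nat" where
  "path_cost I i P = (\<Sum>e\<in>path_edges P. weight I e i)"

definition cost_vector :: "'v mc_instance \<Rightarrow> 'v list \<Rightarrow> nat list" where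
  "cost_vector I P = map (\<lambda>i. path_cost I i P) [1..<Suc (criteria I)]"

definition shorter :: "'v mc_instance \<Rightarrow> 'v list \<Rightarrow> 'v list \<Rightarrow> bool" where
  "shorter I P P' \<longleftrightarrow> (cost_vector I P, cost_vector I P') \<in> lex less_than"

definition shortest_st_path :: "'v mc_instance \<Rightarrow> 'v list \<Rightarrow> bool" where
  "shortest_st_path I P \<longleftrightarrow> st_path I P \<and> \<not> (\<exists>P'. st_path I P' \<and> shorter I P' P)"

text \<open>
  \<open>P \<noteq> P'\<close> makes the solution consist of two paths. In the node-disjoint version this excludes using
  a single edge between \<open>source I\<close> and \<open>target I\<close> twice; in the edge-disjoint version it only matters
  in the degenerate case \<open>source I = target I\<close>.
\<close>

definition node_disjoint_solution :: "'v mc_instance \<Rightarrow> 'v list \<times> 'v list \<Rightarrow> bool" where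
  "node_disjoint_solution I = (\<lambda>(P, P').
     shortest_st_path I P \<and> shortest_st_path I P' \<and> P \<noteq> P' \<and>
     set P \<inter> set P' = {source I, target I})"

definition edge_disjoint_solution :: "'v mc_instance \<Rightarrow> 'v list \<times> 'v list \<Rightarrow> bool" where
  "edge_disjoint_solution I = (\<lambda>(P, P').
     shortest_st_path I P \<and> shortest_st_path I P' \<and> P \<noteq> P' \<and>
     path_edges P \<inter> path_edges P' = {})"


section \<open>Model of computation\<close>

text \<open>
  Algorithms are programs of a first-order, call-by-value, pure LISP: the data are binary trees over
  a single atom, and a program is a finite list of function bodies. Every evaluation step costs one
  time unit. The only primitives are building a pair, taking a component of a pair, and testing for
  the atom; in particular there is no equality test on trees and no arithmetic, so that with shared
  (pointer) representation of trees each step takes constant time, and running time is polynomially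
  related to that of Turing machines.

  Local variables are de Bruijn indices into the environment. The components of the atom are the
  atom, and the atom counts as false.
\<close>

datatype val = Null | Dot val val

datatype expr =
    Var nat
  | NullE
  | DotE expr expr
  | HeadE expr
  | TailE expr
  | IfE expr expr expr
  | LetE expr expr
  | Call nat "expr list"

type_synonym program = "expr list"

fun head :: "val \<Rightarrow> val" where
  "head Null = Null"
| "head (Dot x y) = x"

fun tail :: "val \<Rightarrow> val" where
  "tail Null = Null"
| "tail (Dot x y) = y"

inductive eval :: "program \<Rightarrow> val list \<Rightarrow> expr \<Rightarrow> val \<Rightarrow> nat \<Rightarrow> bool"
  and evals :: "program \<Rightarrow> val list \<Rightarrow> expr list \<Rightarrow> val list \<Rightarrow> nat \<Rightarrow> bool"
  for prog :: program
where
  eval_Var: "i < length env \<Longrightarrow> eval prog env (Var i) (env ! i) 1"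
| eval_Null: "eval prog env NullE Null 1"
| eval_Dot: "eval prog env a x m \<Longrightarrow> eval prog env b y n \<Longrightarrow>
    eval prog env (DotE a b) (Dot x y) (m + n + 1)"
| eval_Head: "eval prog env a x m \<Longrightarrow> eval prog env (HeadE a) (head x) (m + 1)"
| eval_Tail: "eval prog env a x m \<Longrightarrow> eval prog env (TailE a) (tail x) (m + 1)"
| eval_If_true: "eval prog env a x m \<Longrightarrow> x \<noteq> Null \<Longrightarrow> eval prog env b y n \<Longrightarrow>
    eval prog env (IfE a b c) y (m + n + 1)"
| eval_If_false: "eval prog env a Null m \<Longrightarrow> eval prog env c y n \<Longrightarrow>
    eval prog env (IfE a b c) y (m + n + 1)"
| eval_Let: "eval prog env a x m \<Longrightarrow> eval prog (x # env) b y n \<Longrightarrow>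
    eval prog env (LetE a b) y (m + n + 1)"
| eval_Call: "f < length prog \<Longrightarrow> evals prog env as xs m \<Longrightarrow> eval prog xs (prog ! f) y n \<Longrightarrow>
    eval prog env (Call f as) y (m + n + 1)"
| evals_Nil: "evals prog env [] [] 0"
| evals_Cons: "eval prog env a x m \<Longrightarrow> evals prog env as xs n \<Longrightarrow>
    evals prog env (a # as) (x # xs) (m + n)"

inductive_cases eval_elims:
  "eval prog env (Var i) y n"
  "eval prog env NullE y n"
  "eval prog env (DotE a b) y n"
  "eval prog env (HeadE a) y n"
  "eval prog env (TailE a) y n"
  "eval prog env (IfE a b c) y n"
  "eval prog env (LetE a b) y n"
  "eval prog env (Call f as) y n"

inductive_cases evals_elims:
  "evals prog env [] ys n"
  "evals prog env (a # as) ys n"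

lemma eval_deterministic:
  shows "eval prog env e y n \<Longrightarrow> eval prog env e y' n' \<Longrightarrow> y' = y \<and> n' = n"
    and "evals prog env es ys m \<Longrightarrow> evals prog env es ys' m' \<Longrightarrow> ys' = ys \<and> m' = m"
  by (induction arbitrary: y' n' and ys' m' rule: eval_evals.inducts)
    ((erule eval_elims evals_elims; metis Suc_eq_plus1 One_nat_def)+)

text \<open>The entry point of a program is its first function, applied to the input.\<close>

definition runs :: "program \<Rightarrow> val \<Rightarrow> val \<Rightarrow> nat \<Rightarrow> bool" where
  "runs prog x y n \<longleftrightarrow> eval prog [x] (Call 0 [Var 0]) y n"


section \<open>Encodings\<close>

text \<open>The binary digits, least significant first, without leading zeros.\<close>

fun bits :: "nat \<Rightarrow> bool list" where
  "bits n = (if n = 0 then [] else odd n # bits (n div 2))"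

declare bits.simps [simp del]

definition bit_length :: "nat \<Rightarrow> nat" where
  "bit_length n = length (bits n)"

definition enc_bool :: "bool \<Rightarrow> val" where
  "enc_bool b = (if b then Dot Null Null else Null)"

definition enc_list :: "('a \<Rightarrow> val) \<Rightarrow> 'a list \<Rightarrow> val" where
  "enc_list enc xs = foldr (\<lambda>x. Dot (enc x)) xs Null"

definition enc_nat :: "nat \<Rightarrow> val" where
  "enc_nat n = enc_list enc_bool (bits n)"

definition enc_pair :: "('a \<Rightarrow> val) \<Rightarrow> ('b \<Rightarrow> val) \<Rightarrow> 'a \<times> 'b \<Rightarrow> val" where
  "enc_pair enc1 enc2 = (\<lambda>(x, y). Dot (enc1 x) (enc2 y))"

fun enc_option :: "('a \<Rightarrow> val) \<Rightarrow> 'a option \<Rightarrow> val" where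
  "enc_option enc None = Null"
| "enc_option enc (Some x) = Dot Null (enc x)"

text \<open>
  An instance on the nodes \<open>0, \<dots>, n - 1\<close> is given to a program as \<open>n\<close>, \<open>q\<close>, a list of the edges with
  their weight vectors, and the two terminals. The order of the list and the order of the
  two ends of an edge are arbitrary, so an instance has several encodings.
\<close>

definition encodes_instance :: "nat mc_instance \<Rightarrow> val \<Rightarrow> bool" where
  "encodes_instance I x \<longleftrightarrow>
     (\<exists>n es.
        nodes I = {..<n} \<and>
        distinct (map (\<lambda>(u, v). {u, v}) es) \<and>
        edges I = (\<lambda>(u, v). {u, v}) ` set es \<and>
        x = enc_pair enc_nat
              (enc_pair enc_nat
                (enc_pair
                  (enc_list (enc_pair enc_nat (enc_pair enc_nat (enc_list enc_nat))))
                  (enc_pair enc_nat enc_nat)))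
              (n, criteria I,
               map (\<lambda>(u, v). (u, v, map (weight I {u, v}) [1..<Suc (criteria I)])) es,
               source I, target I))"

definition instance_size :: "'v mc_instance \<Rightarrow> nat" where
  "instance_size I =
     card (nodes I) + card (edges I) + criteria I +
     (\<Sum>e\<in>edges I. \<Sum>i\<in>{1..criteria I}. bit_length (weight I e i))"

definition enc_solution :: "(nat list \<times> nat list) option \<Rightarrow> val" where
  "enc_solution = enc_option (enc_pair (enc_list enc_nat) (enc_list enc_nat))"


section \<open>Polynomial-time solvability of search problems\<close>

definition correct_answer :: "('i \<Rightarrow> 'o \<Rightarrow> bool) \<Rightarrow> 'i \<Rightarrow> 'o option \<Rightarrow> bool" where
  "correct_answer sol I ans \<longleftrightarrow>
     (case ans of Some z \<Rightarrow> sol I z | None \<Rightarrow> \<not> (\<exists>z. sol I z))"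

definition poly_time_solvable ::
  "('i \<Rightarrow> bool) \<Rightarrow> ('i \<Rightarrow> val \<Rightarrow> bool) \<Rightarrow> ('i \<Rightarrow> nat) \<Rightarrow> ('o option \<Rightarrow> val) \<Rightarrow>
    ('i \<Rightarrow> 'o \<Rightarrow> bool) \<Rightarrow> bool" where
  "poly_time_solvable valid encodes size_of enc sol \<longleftrightarrow>
     (\<exists>(prog :: program) (p :: nat poly). \<forall>I x. valid I \<longrightarrow> encodes I x \<longrightarrow>
        (\<exists>ans n. runs prog x (enc ans) n \<and> n \<le> poly p (size_of I) \<and> correct_answer sol I ans))"

end

theory Submission
  imports Defs
begin

text \<open>
  Reading the weight vector of an edge as the digits of a single number in a base that exceeds every
  path cost turns the lexicographic order of paths into the order of scalar weights. As the scalar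
  weights are positive, the shortest paths from \<open>s\<close> to \<open>t\<close> are the paths all of whose edges are tight
  for the distance \<open>D\<close> from \<open>s\<close>, and \<open>D\<close> strictly increases along tight edges. Two disjoint tight
  paths are found by growing them simultaneously and always extending the one whose end is closer to
  \<open>s\<close>: the new node is then farther from \<open>s\<close> than every node of the other path except possibly its
  end. So only the last edges of both paths matter for disjointness, and it is enough to remember one
  pair of partial paths for each pair of last edges.

  The algorithm computes \<open>D\<close> by Bellman--Ford iteration and then iterates the growing step; the size
  of the input, in unary, serves as the number of iterations and as the number of digits of the base.
\<close>

section \<open>Programs and their specifications\<close>

text \<open>Why one pair per key is enough: under the invariant of the search, whether an arc may be
  appended to a state is read off from its two last tokens. States that agree in these have the same
  continuations, so either may stand for both. Completeness is therefore claimed only up to last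
  tokens, never for a particular pair of paths. Both versions share one program because disjointness
  is expressed as a relation between arcs. \<open>D\<close> orients every tight edge, so an
  undirected edge shared by two paths is a shared arc. A node shared by two paths, other than the
  source, is entered by an arc of each. The machine has neither arithmetic nor an equality test, so
  numbers are trees and every cost is bounded by tree sizes. These stay polynomial because the base
  is a power of two, which makes scalarising a concatenation of padded digits, and because each of
  the polynomially many additions lengthens a distance by at most one bit.\<close>

fun den :: "(nat \<Rightarrow> val list \<Rightarrow> val) \<Rightarrow> val list \<Rightarrow> expr \<Rightarrow> val" where
  "den F env (Var i) = env ! i"
| "den F env NullE = Null"
| "den F env (DotE a b) = Dot (den F env a) (den F env b)"
| "den F env (HeadE a) = head (den F env a)"
| "den F env (TailE a) = tail (den F env a)"
| "den F env (IfE a b c) = (if den F env a \<noteq> Null then den F env b else den F env c)"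
| "den F env (LetE a b) = den F (den F env a # env) b"
| "den F env (Call f as) = F f (map (den F env) as)"

text \<open>Calls are answered by the oracles \<open>F\<close> and \<open>C\<close>, so
  \<open>den\<close> and \<open>cst\<close> are structurally recursive although programs may
  diverge. An \<open>IfE\<close> must be charged only for the branch taken: at the end of a
  recursion the other branch still contains a recursive call, and no finite bound would satisfy the
  resulting inequality.\<close>

fun cst :: "(nat \<Rightarrow> val list \<Rightarrow> val) \<Rightarrow> (nat \<Rightarrow> val list \<Rightarrow> nat) \<Rightarrow> val list \<Rightarrow> expr \<Rightarrow> nat" where
  "cst F C env (Var i) = 1"
| "cst F C env NullE = 1"
| "cst F C env (DotE a b) = cst F C env a + cst F C env b + 1"
| "cst F C env (HeadE a) = cst F C env a + 1"
| "cst F C env (TailE a) = cst F C env a + 1"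
| "cst F C env (IfE a b c) =
     cst F C env a + (if den F env a \<noteq> Null then cst F C env b else cst F C env c) + 1"
| "cst F C env (LetE a b) = cst F C env a + cst F C (den F env a # env) b + 1"
| "cst F C env (Call f as) = sum_list (map (cst F C env) as) + C f (map (den F env) as) + 1"

fun wf_expr :: "nat list \<Rightarrow> nat \<Rightarrow> expr \<Rightarrow> bool" where
  "wf_expr ars k (Var i) \<longleftrightarrow> i < k"
| "wf_expr ars k NullE \<longleftrightarrow> True"
| "wf_expr ars k (DotE a b) \<longleftrightarrow> wf_expr ars k a \<and> wf_expr ars k b"
| "wf_expr ars k (HeadE a) \<longleftrightarrow> wf_expr ars k a"
| "wf_expr ars k (TailE a) \<longleftrightarrow> wf_expr ars k a"
| "wf_expr ars k (IfE a b c) \<longleftrightarrow> wf_expr ars k a \<and> wf_expr ars k b \<and> wf_expr ars k c"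
| "wf_expr ars k (LetE a b) \<longleftrightarrow> wf_expr ars k a \<and> wf_expr ars (Suc k) b"
| "wf_expr ars k (Call f as) \<longleftrightarrow>
     f < length ars \<and> length as = ars ! f \<and> list_all (wf_expr ars k) as"

lemma evals_pointwise:
  assumes "\<And>a. a \<in> set as \<Longrightarrow> \<exists>n\<le>c a. eval prog env a (d a) n"
  shows "\<exists>n\<le>sum_list (map c as). evals prog env as (map d as) n"
  using assms
proof (induction as)
  case Nil
  then show ?case using evals_Nil by force
next
  case (Cons a as)
  obtain m where "m \<le> c a" "eval prog env a (d a) m" using Cons.prems by auto
  moreover obtain n where "n \<le> sum_list (map c as)" "evals prog env as (map d as) n"
    using Cons by auto
  ultimately show ?case by (auto intro!: exI[of _ "m + n"] evals_Cons)
qed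

text \<open>Restricting \<open>calls\<close> to costs below \<open>K\<close> lets it be discharged
  by a well-founded induction on cost. The restriction is harmless because \<open>cst\<close> adds 1
  for a call itself, so every call executed within \<open>e\<close> costs strictly less than
  \<open>cst F C env e\<close>.\<close>

lemma eval_den_below:
  assumes len: "length ars = length prog"
    and calls: "\<And>f xs. f < length prog \<Longrightarrow> length xs = ars ! f \<Longrightarrow> C f xs < K \<Longrightarrow>
      \<exists>n\<le>C f xs. eval prog xs (prog ! f) (F f xs) n"
    and "wf_expr ars (length env) e" "cst F C env e \<le> K"
  shows "\<exists>n\<le>cst F C env e. eval prog env e (den F env e) n"
  using assms(3,4)
proof (induction e arbitrary: env)
  case (Var i)
  then show ?case using eval_Var by force
next
  case NullE
  then show ?case using eval_Null by force
next
  case (DotE a b)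
  obtain m n where "m \<le> cst F C env a" "eval prog env a (den F env a) m"
    "n \<le> cst F C env b" "eval prog env b (den F env b) n"
    using DotE.IH[of env] DotE.prems by auto
  then show ?case by (auto intro!: exI[of _ "m + n + 1"] eval_Dot[unfolded Suc_eq_plus1[symmetric]])
next
  case (HeadE a)
  obtain m where "m \<le> cst F C env a" "eval prog env a (den F env a) m"
    using HeadE.IH[of env] HeadE.prems by auto
  then show ?case using eval_Head[of prog env a _ m] by (auto intro!: exI[of _ "m + 1"])
next
  case (TailE a)
  obtain m where "m \<le> cst F C env a" "eval prog env a (den F env a) m"
    using TailE.IH[of env] TailE.prems by auto
  then show ?case using eval_Tail[of prog env a _ m] by (auto intro!: exI[of _ "m + 1"])
next
  case (IfE a b c)
  obtain m where m: "m \<le> cst F C env a" "eval prog env a (den F env a) m"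
    using IfE.IH(1)[of env] IfE.prems by auto
  show ?case
  proof (cases "den F env a = Null")
    case True
    obtain n where "n \<le> cst F C env c" "eval prog env c (den F env c) n"
      using IfE.IH(3)[of env] IfE.prems True by auto
    with True m eval_If_false[of prog env a m c _ n b] show ?thesis
      by (auto intro!: exI[of _ "m + n + 1"])
  next
    case False
    obtain n where "n \<le> cst F C env b" "eval prog env b (den F env b) n"
      using IfE.IH(2)[of env] IfE.prems False by auto
    with False m eval_If_true[of prog env a _ m b _ n c] show ?thesis
      by (auto intro!: exI[of _ "m + n + 1"])
  qed
next
  case (LetE a b)
  obtain m n where "m \<le> cst F C env a" "eval prog env a (den F env a) m"
    "n \<le> cst F C (den F env a # env) b"
    "eval prog (den F env a # env) b (den F (den F env a # env) b) n"
    using LetE.IH(1)[of env] LetE.IH(2)[of "den F env a # env"] LetE.prems by auto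
  then show ?case using eval_Let[of prog env a _ m b _ n] by (auto intro!: exI[of _ "m + n + 1"])
next
  case (Call f as)
  have le: "cst F C env a \<le> sum_list (map (cst F C env) as)" if "a \<in> set as" for a
    using that by (intro member_le_sum_list) auto
  have "\<exists>n\<le>cst F C env a. eval prog env a (den F env a) n" if "a \<in> set as" for a
    using Call.IH[OF that, of env] Call.prems le[OF that] that by (auto simp: list_all_iff)
  from evals_pointwise[OF this] obtain m where
    "m \<le> sum_list (map (cst F C env) as)" "evals prog env as (map (den F env) as) m" by blast
  moreover obtain n where "n \<le> C f (map (den F env) as)"
    "eval prog (map (den F env) as) (prog ! f) (F f (map (den F env) as)) n"
    using calls[of f "map (den F env) as"] Call.prems len by auto
  ultimately show ?case using eval_Call[of f prog env as _ m _ n] Call.prems len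
    by (auto intro!: exI[of _ "m + n + 1"])
qed

text \<open>
  The cost bound is its own termination measure: a call is strictly cheaper than the body it
  occurs in. Hence no induction is needed for recursive functions: it is enough that every body agrees
  with \<open>F\<close> and \<open>C\<close> when all the calls in it are interpreted by \<open>F\<close> and \<open>C\<close>.
\<close>

theorem eval_if_locally_correct:
  assumes len: "length ars = length prog"
    and body: "\<And>f xs. f < length prog \<Longrightarrow> length xs = ars ! f \<Longrightarrow>
      wf_expr ars (ars ! f) (prog ! f) \<and>
      den F xs (prog ! f) = F f xs \<and> cst F C xs (prog ! f) \<le> C f xs"
    and "f < length prog" "length xs = ars ! f"
  shows "\<exists>n\<le>C f xs. eval prog xs (prog ! f) (F f xs) n"
  using assms(3,4)
proof (induction "C f xs" arbitrary: f xs rule: less_induct)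
  case less
  have "\<exists>n\<le>cst F C xs (prog ! f). eval prog xs (prog ! f) (den F xs (prog ! f)) n"
    by (rule eval_den_below[OF len, where K = "C f xs"]) (use less body in auto)
  then show ?case using body[OF less.prems] by (metis order_trans)
qed

section \<open>The program: derived syntax and function bodies\<close>

abbreviation TrueE :: expr where "TrueE \<equiv> DotE NullE NullE"
abbreviation NotE :: "expr \<Rightarrow> expr" where "NotE a \<equiv> IfE a NullE TrueE"
abbreviation AndE :: "expr \<Rightarrow> expr \<Rightarrow> expr" where "AndE a b \<equiv> IfE a b NullE"
abbreviation OrE :: "expr \<Rightarrow> expr \<Rightarrow> expr" where "OrE a b \<equiv> IfE a a b"

abbreviation "flatE x acc \<equiv> Call 1 [x, acc]"
abbreviation "padE w l acc \<equiv> Call 2 [w, l, acc]"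
abbreviation "scalarE ws l acc \<equiv> Call 3 [ws, l, acc]"
abbreviation "arcsE es l \<equiv> Call 4 [es, l]"
abbreviation "eqE x y \<equiv> Call 5 [x, y]"
abbreviation "addE x y c \<equiv> Call 6 [x, y, c]"
abbreviation "lessE x y c \<equiv> Call 7 [x, y, c]"
abbreviation "lookupE k T \<equiv> Call 8 [k, T]"
abbreviation "relaxE A T \<equiv> Call 9 [A, T]"
abbreviation "distsE l A i T \<equiv> Call 10 [l, A, i, T]"
abbreviation "tightE A T \<equiv> Call 11 [A, T]"
abbreviation "partnersE a B t fl acc \<equiv> Call 12 [a, B, t, fl, acc]"
abbreviation "keysE A B t fl \<equiv> Call 13 [A, B, t, fl]"
abbreviation "pickE a b S \<equiv> Call 14 [a, b, S]"
abbreviation "moveE K S \<equiv> Call 15 [K, S]"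
abbreviation "searchE l K i S \<equiv> Call 16 [l, K, i, S]"
abbreviation "finishE S t \<equiv> Call 17 [S, t]"
abbreviation "revheadsE P acc \<equiv> Call 18 [P, acc]"

text \<open>
  An arc from \<open>u\<close> to \<open>v\<close> of scalar weight \<open>w\<close> is \<open>(u, (v, w))\<close>, and a distance table is a list of
  pairs \<open>(v, d)\<close>. The token \<open>(v, (u, d))\<close> stands for a tight arc from \<open>u\<close> to \<open>v\<close>, where \<open>d\<close> is the
  distance of \<open>v\<close>. A partial path is the list of its tokens, last arc first, ending with the start
  token \<open>(s, (Null, Null))\<close>, and a search state is a pair of partial paths. The flag \<open>fl\<close> is \<open>NullE\<close>
  for the node-disjoint and \<open>TrueE\<close> for the edge-disjoint version.
\<close>

definition main_body :: "expr \<Rightarrow> expr" where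
  "main_body fl =
     (let es = \<lambda>x. HeadE (TailE (TailE x)); s = \<lambda>x. HeadE (TailE (TailE (TailE x)));
          t = \<lambda>x. TailE (TailE (TailE (TailE x))) in
      LetE (flatE (Var 0) NullE) (
      LetE (arcsE (es (Var 1)) (Var 0)) (
      LetE (distsE (Var 1) (Var 0) (DotE (s (Var 2)) NullE) (DotE (DotE (s (Var 2)) NullE) NullE)) (
      LetE (tightE (Var 1) (Var 0)) (
      LetE (DotE (s (Var 4)) (DotE NullE NullE)) (
      LetE (keysE (Var 1) (DotE (Var 0) (Var 1)) (t (Var 5)) fl) (
      LetE (DotE (DotE (Var 1) NullE) (DotE (Var 1) NullE)) (
      finishE (searchE (flatE (Var 7) (Var 6)) (Var 1) (Var 0) (DotE (Var 0) NullE)) (t (Var 7))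
      ))))))))"

definition flat_body :: expr where
  "flat_body = IfE (Var 0)
     (DotE NullE (flatE (HeadE (Var 0)) (flatE (TailE (Var 0)) (Var 1)))) (Var 1)"

definition pad_body :: expr where
  "pad_body = IfE (Var 1)
     (DotE (HeadE (Var 0)) (padE (TailE (Var 0)) (TailE (Var 1)) (Var 2))) (Var 2)"

definition scalar_body :: expr where
  "scalar_body = IfE (Var 0)
     (scalarE (TailE (Var 0)) (Var 1) (padE (HeadE (Var 0)) (Var 1) (Var 2))) (Var 2)"

definition arcs_body :: expr where
  "arcs_body = IfE (Var 0)
     (LetE (HeadE (Var 0))
     (LetE (scalarE (TailE (TailE (Var 0))) (Var 2) NullE)
       (DotE (DotE (HeadE (Var 1)) (DotE (HeadE (TailE (Var 1))) (Var 0)))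
       (DotE (DotE (HeadE (TailE (Var 1))) (DotE (HeadE (Var 1)) (Var 0)))
         (arcsE (TailE (Var 2)) (Var 3)))))) NullE"

definition eq_body :: expr where
  "eq_body = IfE (Var 0)
     (AndE (Var 1) (AndE (eqE (HeadE (Var 0)) (HeadE (Var 1))) (eqE (TailE (Var 0)) (TailE (Var 1)))))
     (NotE (Var 1))"

definition add_body :: expr where
  "add_body = IfE (OrE (Var 0) (Var 1))
     (DotE
       (IfE (HeadE (Var 0)) (IfE (HeadE (Var 1)) (Var 2) (NotE (Var 2)))
         (IfE (HeadE (Var 1)) (NotE (Var 2)) (Var 2)))
       (addE (TailE (Var 0)) (TailE (Var 1))
         (IfE (HeadE (Var 0)) (IfE (HeadE (Var 1)) TrueE (Var 2))
           (IfE (HeadE (Var 1)) (Var 2) NullE))))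
     (IfE (Var 2) (DotE (Var 2) NullE) NullE)"

definition less_body :: expr where
  "less_body = IfE (OrE (Var 0) (Var 1))
     (lessE (TailE (Var 0)) (TailE (Var 1))
       (IfE (HeadE (Var 0)) (IfE (HeadE (Var 1)) (Var 2) NullE)
         (IfE (HeadE (Var 1)) TrueE (Var 2))))
     (Var 2)"

definition lookup_body :: expr where
  "lookup_body = IfE (Var 1)
     (LetE (lookupE (Var 0) (TailE (Var 1)))
       (IfE (eqE (Var 1) (HeadE (HeadE (Var 2))))
         (IfE (AndE (Var 0) (NotE (lessE (TailE (HeadE (Var 2))) (TailE (Var 0)) NullE)))
           (Var 0) (HeadE (Var 2)))
         (Var 0)))
     NullE"

definition relax_body :: expr where
  "relax_body = IfE (Var 0)
     (LetE (relaxE (TailE (Var 0)) (Var 1))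
     (LetE (lookupE (HeadE (HeadE (Var 1))) (Var 2))
       (IfE (Var 0)
         (DotE (DotE (HeadE (TailE (HeadE (Var 2))))
             (addE (TailE (Var 0)) (TailE (TailE (HeadE (Var 2)))) NullE)) (Var 1))
         (Var 1))))
     NullE"

definition dists_body :: expr where
  "dists_body = IfE (Var 0)
     (distsE (TailE (Var 0)) (Var 1) (Var 2) (DotE (Var 2) (relaxE (Var 1) (Var 3)))) (Var 3)"

definition tight_body :: expr where
  "tight_body = IfE (Var 0)
     (LetE (tightE (TailE (Var 0)) (Var 1))
     (LetE (lookupE (HeadE (HeadE (Var 1))) (Var 2))
     (LetE (lookupE (HeadE (TailE (HeadE (Var 2)))) (Var 3))
       (IfE (AndE (Var 1)
              (NotE (lessE (TailE (Var 0))
                 (addE (TailE (Var 1)) (TailE (TailE (HeadE (Var 3)))) NullE) NullE)))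
         (DotE (DotE (HeadE (TailE (HeadE (Var 3))))
             (DotE (HeadE (HeadE (Var 3))) (TailE (Var 0)))) (Var 2))
         (Var 2)))))
     NullE"

definition partners_body :: expr where
  "partners_body = IfE (Var 1)
     (LetE (partnersE (Var 0) (TailE (Var 1)) (Var 2) (Var 3) (Var 4))
       (IfE (AndE (NotE (eqE (Var 1) (HeadE (Var 2))))
           (OrE (Var 4) (OrE (NotE (eqE (HeadE (Var 1)) (HeadE (HeadE (Var 2)))))
              (eqE (HeadE (Var 1)) (Var 3)))))
         (DotE (DotE (Var 1) (HeadE (Var 2))) (Var 0))
         (Var 0)))
     (Var 4)"

definition keys_body :: expr where
  "keys_body = IfE (Var 0)
     (partnersE (HeadE (Var 0)) (Var 1) (Var 2) (Var 3)
       (keysE (TailE (Var 0)) (Var 1) (Var 2) (Var 3)))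
     NullE"

definition pick_body :: expr where
  "pick_body = IfE (Var 2)
     (LetE (HeadE (Var 2))
       (IfE (AndE (eqE (Var 2) (HeadE (TailE (Var 0))))
            (AndE (eqE (HeadE (TailE (Var 1))) (HeadE (HeadE (HeadE (Var 0)))))
              (lessE (TailE (TailE (HeadE (HeadE (Var 0))))) (TailE (TailE (HeadE (TailE (Var 0)))))
                 TrueE)))
         (Var 0)
         (pickE (Var 1) (Var 2) (TailE (Var 3)))))
     NullE"

definition move_body :: expr where
  "move_body = IfE (Var 0)
     (LetE (moveE (TailE (Var 0)) (Var 1))
     (LetE (pickE (HeadE (HeadE (Var 1))) (TailE (HeadE (Var 1))) (Var 2))
       (IfE (Var 0)
         (LetE (DotE (HeadE (HeadE (Var 2))) (HeadE (Var 0)))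
           (DotE (DotE (Var 0) (TailE (Var 1))) (DotE (DotE (TailE (Var 1)) (Var 0)) (Var 2))))
         (Var 1))))
     NullE"

definition search_body :: expr where
  "search_body = IfE (Var 0)
     (searchE (TailE (Var 0)) (Var 1) (Var 2) (DotE (Var 2) (moveE (Var 1) (Var 3)))) (Var 3)"

definition finish_body :: expr where
  "finish_body = IfE (Var 0)
     (LetE (HeadE (HeadE (Var 0)))
     (LetE (TailE (HeadE (Var 1)))
       (IfE (AndE (eqE (HeadE (HeadE (Var 1))) (Var 3))
            (AndE (eqE (HeadE (HeadE (Var 0))) (Var 3))
               (NotE (eqE (HeadE (Var 1)) (HeadE (Var 0))))))
         (DotE NullE (DotE (revheadsE (Var 1) NullE) (revheadsE (Var 0) NullE)))
         (finishE (TailE (Var 2)) (Var 3)))))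
     NullE"

definition revheads_body :: expr where
  "revheads_body = IfE (Var 0)
     (revheadsE (TailE (Var 0)) (DotE (HeadE (HeadE (Var 0))) (Var 1))) (Var 1)"

definition prog :: "expr \<Rightarrow> program" where
  "prog fl = [main_body fl, flat_body, pad_body, scalar_body, arcs_body, eq_body, add_body,
     less_body, lookup_body, relax_body, dists_body, tight_body, partners_body, keys_body,
     pick_body, move_body, search_body, finish_body, revheads_body]"

definition arity_list :: "nat list" where
  "arity_list = [1, 2, 3, 3, 2, 2, 3, 3, 2, 2, 4, 2, 5, 4, 3, 2, 4, 2, 2]"

section \<open>The functions computed by the program\<close>

abbreviation TT :: val where "TT \<equiv> Dot Null Null"

text \<open>In contrast to \<open>enc_nat\<close>, the numbers computed by the program may have leading zeros.\<close>

fun num :: "val \<Rightarrow> nat" where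
  "num Null = 0"
| "num (Dot b x) = of_bool (b \<noteq> Null) + 2 * num x"

fun lst :: "val \<Rightarrow> val list" where
  "lst Null = []"
| "lst (Dot x y) = x # lst y"

abbreviation len :: "val \<Rightarrow> nat" where "len x \<equiv> length (lst x)"

definition flat :: "val \<Rightarrow> val \<Rightarrow> val" where
  "flat x acc = (Dot Null ^^ size x) acc"

text \<open>A Horner step to a base \<open>2 ^ len l\<close> is concatenation: the bits of
  \<open>w\<close>, filled up with zeros, come first and \<open>acc\<close> becomes the more
  significant part. Thus \<open>scalar\<close> makes the first criterion the most significant
  one.\<close>

fun pad :: "val \<Rightarrow> val \<Rightarrow> val \<Rightarrow> val" where
  "pad w Null acc = acc"
| "pad w (Dot _ l) acc = Dot (head w) (pad (tail w) l acc)"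

fun scalar :: "val \<Rightarrow> val \<Rightarrow> val \<Rightarrow> val" where
  "scalar Null l acc = acc"
| "scalar (Dot w ws) l acc = scalar ws l (pad w l acc)"

fun arcs :: "val \<Rightarrow> val \<Rightarrow> val" where
  "arcs Null l = Null"
| "arcs (Dot e es) l =
     (let w = scalar (tail (tail e)) l Null in
      Dot (Dot (head e) (Dot (head (tail e)) w))
     (Dot (Dot (head (tail e)) (Dot (head e) w)) (arcs es l)))"

text \<open>The program compares from the least significant bit on. The carry \<open>c\<close> is
  the verdict on the bits already read, which a higher differing bit overrides. Started with
  \<open>Null\<close> it decides strict, with \<open>TT\<close> non-strict comparison.\<close>

definition less_carry :: "val \<Rightarrow> val \<Rightarrow> val \<Rightarrow> val" where
  "less_carry x y c = (if num x < num y then TT else if num x = num y then c else Null)"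

function add :: "val \<Rightarrow> val \<Rightarrow> val \<Rightarrow> val" where
  "add x y c =
    (if x = Null \<and> y = Null then (if c \<noteq> Null then Dot c Null else Null)
     else let a = head x \<noteq> Null; b = head y \<noteq> Null; nc = (if c \<noteq> Null then Null else TT) in
       Dot (if a = b then c else nc)
         (add (tail x) (tail y) (if a \<noteq> b then c else if a then TT else Null)))"
  by auto
termination
proof (relation "measure (\<lambda>(x, y, c). size x + size y)", goal_cases)
  case (2 x y c)
  then show ?case by (cases x; cases y) auto
qed simp

declare add.simps [simp del]

lemma add_simps [simp]:
  "add Null Null c = (if c \<noteq> Null then Dot c Null else Null)"
  "add (Dot a x) Null c =
     Dot (if a = Null then c else if c = Null then TT else Null) (add x Null (if a = Null then Null else c))"
  "add Null (Dot b y) c =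
     Dot (if b = Null then c else if c = Null then TT else Null) (add Null y (if b = Null then Null else c))"
  "add (Dot a x) (Dot b y) c =
     Dot (if (a = Null) = (b = Null) then c else if c = Null then TT else Null)
       (add x y (if (a = Null) \<noteq> (b = Null) then c else if a = Null then Null else TT))"
  by (subst add.simps; simp)+

text \<open>Each round of \<open>relax\<close> lists one candidate per usable arc, so a node may
  have several entries. Taking the minimum on reading avoids updating the table and keeps its length
  linear in the number of arcs.\<close>

fun lookup :: "val \<Rightarrow> val \<Rightarrow> val" where
  "lookup k Null = Null"
| "lookup k (Dot e T) =
     (let r = lookup k T in
      if k = head e \<and> (r = Null \<or> num (tail e) < num (tail r)) then e else r)"

fun relax :: "val \<Rightarrow> val \<Rightarrow> val" where
  "relax Null T = Null"
| "relax (Dot a A) T =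
     (let r = lookup (head a) T in
      if r \<noteq> Null
      then Dot (Dot (head (tail a)) (add (tail r) (tail (tail a)) Null)) (relax A T)
      else relax A T)"

text \<open>As \<open>relax\<close> builds the new table from scratch, the entry \<open>i\<close> of
  the source is put back in every round. Hence round \<open>k\<close> accounts for walks with at
  most, not exactly, \<open>k\<close> arcs.\<close>

fun dists :: "val \<Rightarrow> val \<Rightarrow> val \<Rightarrow> val \<Rightarrow> val" where
  "dists Null A i T = T"
| "dists (Dot _ l) A i T = dists l A i (Dot i (relax A T))"

fun tight :: "val \<Rightarrow> val \<Rightarrow> val" where
  "tight Null T = Null"
| "tight (Dot a A) T =
     (let r = lookup (head a) T; r' = lookup (head (tail a)) T in
      if r \<noteq> Null \<and> num (tail r) + num (tail (tail a)) \<le> num (tail r')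
      then Dot (Dot (head (tail a)) (Dot (head a) (tail r'))) (tight A T)
      else tight A T)"

text \<open>In the node-disjoint version both paths may enter the target \<open>t\<close>, but
  \<open>a \<noteq> b\<close> forbids doing so by the same arc. This excludes using one
  source-target edge twice.\<close>

definition compatible :: "val \<Rightarrow> val \<Rightarrow> val \<Rightarrow> val \<Rightarrow> bool" where
  "compatible t fl a b \<longleftrightarrow> a \<noteq> b \<and> (fl \<noteq> Null \<or> head a \<noteq> head b \<or> head a = t)"

fun partners :: "val \<Rightarrow> val \<Rightarrow> val \<Rightarrow> val \<Rightarrow> val \<Rightarrow> val" where
  "partners a Null t fl acc = acc"
| "partners a (Dot b B) t fl acc =
     (if compatible t fl a b then Dot (Dot a b) (partners a B t fl acc)
      else partners a B t fl acc)"

fun keys :: "val \<Rightarrow> val \<Rightarrow> val \<Rightarrow> val \<Rightarrow> val" where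
  "keys Null B t fl = Null"
| "keys (Dot a A) B t fl = partners a B t fl (keys A B t fl)"

abbreviation rank :: "val \<Rightarrow> nat" where "rank a \<equiv> num (tail (tail a))"

definition extends :: "val \<Rightarrow> val \<Rightarrow> val \<Rightarrow> bool" where
  "extends a b S \<longleftrightarrow> b = head (tail S) \<and> head (tail a) = head (head (head S)) \<and>
     rank (head (head S)) \<le> rank (head (tail S))"

fun pick :: "val \<Rightarrow> val \<Rightarrow> val \<Rightarrow> val" where
  "pick a b Null = Null"
| "pick a b (Dot S Ss) = (if extends a b S then S else pick a b Ss)"

text \<open>Storing each new state in both orders means that only the first path of a state ever has
  to be extended. A key adds at most two states however many states match it, which keeps the list
  polynomial.\<close>

fun move :: "val \<Rightarrow> val \<Rightarrow> val" where
  "move Null S = Null"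
| "move (Dot k K) S =
     (let r = pick (head k) (tail k) S; p = Dot (head k) (head r) in
      if r \<noteq> Null then Dot (Dot p (tail r)) (Dot (Dot (tail r) p) (move K S)) else move K S)"

fun search :: "val \<Rightarrow> val \<Rightarrow> val \<Rightarrow> val \<Rightarrow> val" where
  "search Null K i S = S"
| "search (Dot _ l) K i S = search l K i (Dot i (move K S))"

fun revheads :: "val \<Rightarrow> val \<Rightarrow> val" where
  "revheads Null acc = acc"
| "revheads (Dot a P) acc = revheads P (Dot (head a) acc)"

text \<open>Last arcs of compatible paths differ, so among the states built by the search the
  inequality rejects only the pair of trivial paths, which arises when source and target
  coincide.\<close>

definition final :: "val \<Rightarrow> val \<Rightarrow> bool" where
  "final t S \<longleftrightarrow> head (head (head S)) = t \<and> head (head (tail S)) = t \<and>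
     head (head S) \<noteq> head (tail S)"

fun finish :: "val \<Rightarrow> val \<Rightarrow> val" where
  "finish Null t = Null"
| "finish (Dot S Ss) t =
     (if final t S then Dot Null (Dot (revheads (head S) Null) (revheads (tail S) Null))
      else finish Ss t)"

text \<open>A round is charged by the table it finds, so the cost follows the recursion of
  \<open>dists\<close>. A closed form has to wait for an invariant on the sizes of the
  tables.\<close>

fun dists_cost :: "val \<Rightarrow> val \<Rightarrow> val \<Rightarrow> val \<Rightarrow> nat" where
  "dists_cost Null A i T = 20"
| "dists_cost (Dot _ l) A i T =
     20 + 500 * (1 + len A) * (1 + len T) * (1 + size A + size T) + dists_cost l A i (Dot i (relax A T))"

fun search_cost :: "val \<Rightarrow> val \<Rightarrow> val \<Rightarrow> val \<Rightarrow> nat" where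
  "search_cost Null K i S = 20"
| "search_cost (Dot _ l) K i S =
     20 + 500 * (1 + len K) * (1 + len S) * (1 + size K + size S) + search_cost l K i (Dot i (move K S))"

section \<open>Intermediate results and cost of the main function\<close>

definition the_arcs :: "val \<Rightarrow> val" where
  "the_arcs x = arcs (head (tail (tail x))) (flat x Null)"

definition the_source :: "val \<Rightarrow> val" where
  "the_source x = head (tail (tail (tail x)))"

definition the_target :: "val \<Rightarrow> val" where
  "the_target x = tail (tail (tail (tail x)))"

definition the_dists :: "val \<Rightarrow> val" where
  "the_dists x = dists (flat x Null) (the_arcs x) (Dot (the_source x) Null)
     (Dot (Dot (the_source x) Null) Null)"

definition the_tokens :: "val \<Rightarrow> val" where
  "the_tokens x = tight (the_arcs x) (the_dists x)"

definition start_token :: "val \<Rightarrow> val" where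
  "start_token x = Dot (the_source x) (Dot Null Null)"

definition the_keys :: "val \<Rightarrow> val \<Rightarrow> val" where
  "the_keys fl x =
     keys (the_tokens x) (Dot (start_token x) (the_tokens x)) (the_target x) fl"

definition start_state :: "val \<Rightarrow> val" where
  "start_state x = Dot (Dot (start_token x) Null) (Dot (start_token x) Null)"

definition the_states :: "val \<Rightarrow> val \<Rightarrow> val" where
  "the_states fl x = search (flat x (flat x Null)) (the_keys fl x) (start_state x)
     (Dot (start_state x) Null)"

definition main :: "val \<Rightarrow> val \<Rightarrow> val" where
  "main fl x = finish (the_states fl x) (the_target x)"

definition arcs_cost :: "val \<Rightarrow> val \<Rightarrow> nat" where
  "arcs_cost es l = 100 * (1 + len es) * (1 + size es) * (1 + size l)"

definition tight_cost :: "val \<Rightarrow> val \<Rightarrow> nat" where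
  "tight_cost A T = 1000 * (1 + len A) * (1 + len T) * (1 + size A + size T)"

definition keys_cost :: "val \<Rightarrow> val \<Rightarrow> nat" where
  "keys_cost A B = 200 * (1 + len A) * (1 + len B) * (1 + size A)"

definition finish_cost :: "val \<Rightarrow> nat" where
  "finish_cost S = 100 * (1 + len S) * (1 + size S)"

definition main_cost :: "val \<Rightarrow> val \<Rightarrow> nat" where
  "main_cost fl x = 200 + 100 * (1 + size x) +
     arcs_cost (head (tail (tail x))) (flat x Null) +
     dists_cost (flat x Null) (the_arcs x) (Dot (the_source x) Null)
       (Dot (Dot (the_source x) Null) Null) +
     tight_cost (the_arcs x) (the_dists x) +
     keys_cost (the_tokens x) (Dot (start_token x) (the_tokens x)) +
     search_cost (flat x (flat x Null)) (the_keys fl x) (start_state x) (Dot (start_state x) Null) +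
     finish_cost (the_states fl x)"

definition sem :: "val \<Rightarrow> nat \<Rightarrow> val list \<Rightarrow> val" where
  "sem fl f xs =
    ([\<lambda>xs. main fl (xs ! 0),
      \<lambda>xs. flat (xs ! 0) (xs ! 1),
      \<lambda>xs. pad (xs ! 0) (xs ! 1) (xs ! 2),
      \<lambda>xs. scalar (xs ! 0) (xs ! 1) (xs ! 2),
      \<lambda>xs. arcs (xs ! 0) (xs ! 1),
      \<lambda>xs. enc_bool (xs ! 0 = xs ! 1),
      \<lambda>xs. add (xs ! 0) (xs ! 1) (xs ! 2),
      \<lambda>xs. less_carry (xs ! 0) (xs ! 1) (xs ! 2),
      \<lambda>xs. lookup (xs ! 0) (xs ! 1),
      \<lambda>xs. relax (xs ! 0) (xs ! 1),
      \<lambda>xs. dists (xs ! 0) (xs ! 1) (xs ! 2) (xs ! 3),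
      \<lambda>xs. tight (xs ! 0) (xs ! 1),
      \<lambda>xs. partners (xs ! 0) (xs ! 1) (xs ! 2) (xs ! 3) (xs ! 4),
      \<lambda>xs. keys (xs ! 0) (xs ! 1) (xs ! 2) (xs ! 3),
      \<lambda>xs. pick (xs ! 0) (xs ! 1) (xs ! 2),
      \<lambda>xs. move (xs ! 0) (xs ! 1),
      \<lambda>xs. search (xs ! 0) (xs ! 1) (xs ! 2) (xs ! 3),
      \<lambda>xs. finish (xs ! 0) (xs ! 1),
      \<lambda>xs. revheads (xs ! 0) (xs ! 1)] ! f) xs"

text \<open>These are generous solutions of the cost inequalities of the bodies. The factor
  \<open>1 + 2 * size\<close> counts all nodes of a tree, leaves included, since \<open>size\<close>
  counts only the \<open>Dot\<close> cells.\<close>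

definition cost :: "val \<Rightarrow> nat \<Rightarrow> val list \<Rightarrow> nat" where
  "cost fl f xs =
    ([\<lambda>xs. main_cost fl (xs ! 0),
      \<lambda>xs. 20 * (1 + 2 * size (xs ! 0)),
      \<lambda>xs. 20 * (1 + size (xs ! 1)),
      \<lambda>xs. 50 * (1 + len (xs ! 0)) * (1 + size (xs ! 1)),
      \<lambda>xs. arcs_cost (xs ! 0) (xs ! 1),
      \<lambda>xs. 20 * (1 + 2 * size (xs ! 0)),
      \<lambda>xs. 50 * (1 + size (xs ! 0) + size (xs ! 1)),
      \<lambda>xs. 40 * (1 + size (xs ! 0) + size (xs ! 1)),
      \<lambda>xs. 100 * (1 + len (xs ! 1)) * (1 + size (xs ! 0) + size (xs ! 1)),
      \<lambda>xs. 500 * (1 + len (xs ! 0)) * (1 + len (xs ! 1)) * (1 + size (xs ! 0) + size (xs ! 1)),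
      \<lambda>xs. dists_cost (xs ! 0) (xs ! 1) (xs ! 2) (xs ! 3),
      \<lambda>xs. tight_cost (xs ! 0) (xs ! 1),
      \<lambda>xs. 200 * (1 + len (xs ! 1)) * (1 + size (xs ! 0)),
      \<lambda>xs. keys_cost (xs ! 0) (xs ! 1),
      \<lambda>xs. 100 * (1 + len (xs ! 2)) * (1 + size (xs ! 0) + size (xs ! 1) + size (xs ! 2)),
      \<lambda>xs. 500 * (1 + len (xs ! 0)) * (1 + len (xs ! 1)) * (1 + size (xs ! 0) + size (xs ! 1)),
      \<lambda>xs. search_cost (xs ! 0) (xs ! 1) (xs ! 2) (xs ! 3),
      \<lambda>xs. finish_cost (xs ! 0),
      \<lambda>xs. 20 * (1 + size (xs ! 0))] ! f) xs"

lemmas call_simps = sem_def cost_def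

lemma size_head_tail_le: "size (head x) \<le> size x" "size (tail x) \<le> size x"
  by (cases x; simp)+

lemma enc_bool_eq_Null [simp]: "enc_bool b = Null \<longleftrightarrow> \<not> b"
  by (simp add: enc_bool_def)

abbreviation sound :: "val \<Rightarrow> nat \<Rightarrow> expr \<Rightarrow> val list \<Rightarrow> bool" where
  "sound fl f body xs \<equiv> den (sem fl) xs body = sem fl f xs \<and>
     cst (sem fl) (cost fl) xs body \<le> cost fl f xs"


section \<open>Local correctness of the program\<close>

lemma sound_flat: "sound fl 1 flat_body [x, acc]"
  by (cases x) (simp_all add: flat_body_def call_simps flat_def funpow_add funpow_swap1)

lemma sound_pad: "sound fl 2 pad_body [w, l, acc]"
  by (cases l) (simp_all add: pad_body_def call_simps)

lemma sound_scalar: "sound fl 3 scalar_body [ws, l, acc]"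
  by (cases ws) (simp_all add: scalar_body_def call_simps algebra_simps)

lemma len_le_size: "len x \<le> size x"
  by (induction x) auto

lemma sound_arcs: "sound fl 4 arcs_body [es, l]"
proof (cases es)
  case (Dot e es')
  have "len (tail (tail e)) \<le> size e"
    by (meson len_le_size size_head_tail_le order_trans)
  then have "len (tail (tail e)) * (1 + size l) \<le> size e * (1 + size l)"
    by (rule mult_right_mono) simp
  with Dot show ?thesis
    by (simp add: arcs_body_def call_simps arcs_cost_def Let_def algebra_simps)
qed (simp add: arcs_body_def call_simps arcs_cost_def)

lemma sound_eq: "sound fl 5 eq_body [x, y]"
  by (cases x; cases y) (auto simp: eq_body_def call_simps enc_bool_def)

lemma sound_add: "sound fl 6 add_body [x, y, c]"
  by (cases x; cases y) 
   (auto simp: add_body_def call_simps)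

lemma sound_less: "sound fl 7 less_body [x, y, c]"
  by (cases x; cases y) 
   (auto simp: less_body_def call_simps less_carry_def of_bool_def)

lemma size_lookup_le: "size (lookup k T) \<le> size T"
  by (induction T) (auto simp: Let_def)

lemma sound_lookup: "sound fl 8 lookup_body [k, T]"
proof (cases T)
  case (Dot e T')
  have "size (tail e) \<le> size e" "size (tail (lookup k T')) \<le> size T'"
    using size_head_tail_le size_lookup_le order_trans by blast+
  with Dot show ?thesis
    by (auto simp: lookup_body_def call_simps Let_def less_carry_def algebra_simps)
qed (simp add: lookup_body_def call_simps)

lemma num_add: "num (add x y c) = num x + num y + of_bool (c \<noteq> Null)"
proof (induction x arbitrary: y c)
  case Null
  then show ?case by (induction y arbitrary: c) auto
next
  case (Dot a x)
  then show ?case by (cases y) auto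
qed

lemma sound_relax: "sound fl 9 relax_body [A, T]"
proof (cases A)
  case (Dot a A')
  have "size (head a) \<le> size a" "size (tail (tail a)) \<le> size a"
    "size (tail (lookup (head a) T)) \<le> size T"
    by (meson size_head_tail_le size_lookup_le order_trans)+
  \<comment> \<open>An equation can be substituted into the products of lengths and sizes and
    expanded there; what remains is linear in the monomials.\<close>
  moreover from this(1) obtain j where "size a = size (head a) + j"
    using le_Suc_ex by blast
  ultimately show ?thesis using Dot
    by (auto simp: relax_body_def call_simps Let_def algebra_simps)
qed (simp add: relax_body_def call_simps)

lemma sound_dists: "sound fl 10 dists_body [l, A, i, T]"
  by (cases l) (simp_all add: dists_body_def call_simps)

text \<open>Every digit of the sum is \<open>Null\<close>, \<open>TT\<close> or the carry, never a
  copy of an input digit. So a digit takes at most two cells, one of them in the list, however large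
  the digits of \<open>x\<close> and \<open>y\<close> are as trees.\<close>

lemma size_add_le:
  "size c \<le> 1 \<Longrightarrow>
     size (add x y c) \<le> 2 * (1 + max (len x) (len y)) \<and> len (add x y c) \<le> 1 + max (len x) (len y)"
proof (induction x arbitrary: y c)
  case Null
  then show ?case
  proof (induction y arbitrary: c)
    case (Dot b y)
    show ?case using Dot.prems Dot.IH(2)[of c] Dot.IH(2)[of Null] by auto
  qed auto
next
  case (Dot a x)
  note IH = Dot.IH(2)[OF _]
  show ?case
  proof (cases y)
    case Null
    then show ?thesis using Dot.prems IH[of c Null] IH[of Null Null] by auto
  next
    case (Dot b y')
    then show ?thesis using \<open>size c \<le> 1\<close> IH[of c y'] IH[of Null y'] IH[of TT y'] by auto
  qed
qed

lemma size_add_Null_le: "size (add x y Null) \<le> 2 * (1 + size x + size y)"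
  using size_add_le[of Null x y] len_le_size[of x] len_le_size[of y] by auto

lemma sound_tight: "sound fl 11 tight_body [A, T]"
proof (cases A)
  case (Dot a A')
  let ?r = "lookup (head a) T" and ?r' = "lookup (head (tail a)) T"
  let ?s = "add (tail ?r) (tail (tail a)) Null"
  have "size (head a) + size (head (tail a)) \<le> size a" 
    by (cases a; cases "tail a") auto
  moreover from this obtain j where "size a = size (head a) + size (head (tail a)) + j"
    using le_Suc_ex by blast
  moreover have "size (tail (tail a)) \<le> size a"
    "size (tail ?r) \<le> size T" "size (tail ?r') \<le> size T"
    by (meson size_head_tail_le size_lookup_le order_trans)+
  moreover have "size ?s \<le> 2 * (1 + size (tail ?r) + size (tail (tail a)))"
    by (rule size_add_Null_le)
  ultimately show ?thesis using Dot
    by (auto simp: tight_body_def tight_cost_def call_simps Let_def less_carry_def num_add algebra_simps)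
qed (simp add: tight_body_def tight_cost_def call_simps)

lemma sound_partners: "sound fl 12 partners_body [a, B, t, fl', acc]"
proof (cases B)
  case (Dot b B')
  have "size (head a) \<le> size a" by (meson size_head_tail_le)
  with Dot show ?thesis
    by (auto simp: partners_body_def call_simps compatible_def algebra_simps)
qed (simp add: partners_body_def call_simps)

lemma sound_keys: "sound fl 13 keys_body [A, B, t, fl']"
  by (cases A) (simp_all add: keys_body_def call_simps keys_cost_def algebra_simps)

lemma sound_pick: "sound fl 14 pick_body [a, b, S]"
proof (cases S)
  case (Dot S' Ss)
  have "size (head (tail a)) \<le> size a" "size (tail (tail (head (head S')))) \<le> size S'"
    "size (tail (tail (head (tail S')))) \<le> size S'"
    by (meson size_head_tail_le order_trans)+
  with Dot show ?thesis
    by (auto simp: pick_body_def call_simps extends_def less_carry_def algebra_simps)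
qed (simp add: pick_body_def call_simps)

lemma sound_move: "sound fl 15 move_body [K, S]"
proof (cases K)
  case (Dot k K')
  have "size (head k) \<le> size k" "size (tail k) \<le> size k" 
    by (meson size_head_tail_le)+
  moreover have "size (head k) + size (tail k) \<le> size k" by (cases k) auto
  moreover from this obtain j where "size k = size (head k) + size (tail k) + j"
    using le_Suc_ex by blast
  ultimately show ?thesis using Dot
    by (auto simp: move_body_def call_simps Let_def algebra_simps)
qed (simp add: move_body_def call_simps)

lemma sound_search: "sound fl 16 search_body [l, K, i, S]"
  by (cases l) (simp_all add: search_body_def call_simps)

lemma sound_finish: "sound fl 17 finish_body [S, t]"
proof (cases S)
  case (Dot S' Ss)
  have "size (head (head (head S'))) \<le> size S'" "size (head (head (tail S'))) \<le> size S'"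
    "size (head (head S')) \<le> size S'" "size (head S') \<le> size S'" "size (tail S') \<le> size S'"
    by (meson size_head_tail_le order_trans)+
  with Dot show ?thesis
    by (auto simp: finish_body_def call_simps final_def finish_cost_def algebra_simps)
qed (simp add: finish_body_def call_simps finish_cost_def)

lemma sound_revheads: "sound fl 18 revheads_body [P, acc]"
  by (cases P) (simp_all add: revheads_body_def call_simps)

lemma sound_main:
  assumes "fl = NullE \<or> fl = TrueE" "fl' = (if fl = NullE then Null else TT)"
  shows "sound fl' 0 (main_body fl) [x]"
  using assms
  by (elim disjE) (simp_all add: main_body_def Let_def call_simps the_arcs_def the_source_def
    the_target_def the_dists_def the_tokens_def start_token_def the_keys_def start_state_def the_states_def
    main_def main_cost_def)

lemmas sounds = sound_main sound_flat sound_pad sound_scalar sound_arcs sound_eq sound_add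
  sound_less sound_lookup sound_relax sound_dists sound_tight sound_partners sound_keys sound_pick
  sound_move sound_search sound_finish sound_revheads

lemma prog_wf:
  assumes "fl = NullE \<or> fl = TrueE" "f < length (prog fl)"
  shows "wf_expr arity_list (arity_list ! f) (prog fl ! f)"
proof -
  have "\<forall>f<length (prog fl). wf_expr arity_list (arity_list ! f) (prog fl ! f)"
    using assms(1)
    by (auto simp: prog_def arity_list_def All_less_Suc Let_def main_body_def flat_body_def pad_body_def
      scalar_body_def arcs_body_def eq_body_def add_body_def less_body_def lookup_body_def
      relax_body_def dists_body_def tight_body_def partners_body_def keys_body_def pick_body_def
      move_body_def search_body_def finish_body_def revheads_body_def)
  with assms(2) show ?thesis by blast
qed

lemma length_eq_numeral:
  "length xs = 1 \<Longrightarrow> \<exists>a. xs = [a]"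
  "length xs = 2 \<Longrightarrow> \<exists>a b. xs = [a, b]"
  "length xs = 3 \<Longrightarrow> \<exists>a b c. xs = [a, b, c]"
  "length xs = 4 \<Longrightarrow> \<exists>a b c d. xs = [a, b, c, d]"
  "length xs = 5 \<Longrightarrow> \<exists>a b c d e. xs = [a, b, c, d, e]"
  by (auto simp: numeral_eq_Suc length_Suc_conv)

lemma runs_prog:
  assumes "fl = NullE \<or> fl = TrueE" and "fl' = (if fl = NullE then Null else TT)"
  shows "\<exists>n\<le>main_cost fl' x + 2. runs (prog fl) x (main fl' x) n"
proof -
  have sound: "sound fl' f (prog fl ! f) xs"
    if "f < length (prog fl)" "length xs = arity_list ! f" for f xs
  proof -
    have main: "sound fl' 0 (main_body fl) [x]" for x
      by (rule sound_main) (use assms in auto)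
    have "f \<in> {0, 1, 2, 3, 4, 5, 6, 7, 8, 9, 10, 11, 12, 13, 14, 15, 16, 17, 18}"
      using that(1) by (simp add: prog_def) presburger
    then show ?thesis using that(2)
      by (elim insertE)
        (auto simp: prog_def arity_list_def sounds(2-)[unfolded One_nat_def] main
          dest!: length_eq_numeral[unfolded One_nat_def])
  qed
  have "\<exists>n\<le>cost fl' 0 [x]. eval (prog fl) [x] (prog fl ! 0) (sem fl' 0 [x]) n"
    by (rule eval_if_locally_correct[where ars = arity_list])
      (use sound prog_wf[OF assms(1)] in \<open>auto simp: prog_def arity_list_def\<close>)
  then obtain n where "n \<le> main_cost fl' x" "eval (prog fl) [x] (prog fl ! 0) (main fl' x) n"
    by (auto simp: cost_def sem_def)
  \<comment> \<open>The argument costs one step and the call itself another, which gives the summand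
    2.\<close>
  moreover have "evals (prog fl) [x] [Var 0] [x] (1 + 0)"
    by (rule evals_Cons[OF eval_Var[of 0 "[x]", simplified nth_Cons_0] evals_Nil]) simp
  ultimately show ?thesis
    unfolding runs_def using eval_Call[of 0 "prog fl" "[x]" "[Var 0]" "[x]" 1 "main fl' x" n]
    by (auto simp: prog_def intro!: exI[of _ "n + 2"])
qed


section \<open>Polynomial bounds\<close>

definition poly_bounded :: "(nat \<Rightarrow> nat) \<Rightarrow> bool" where
  "poly_bounded f \<longleftrightarrow> (\<exists>p :: nat poly. \<forall>n. f n \<le> poly p n)"

lemma poly_bounded_const: "poly_bounded (\<lambda>n. c)"
  unfolding poly_bounded_def by (rule exI[of _ "[:c:]"]) simp

lemma poly_bounded_id: "poly_bounded (\<lambda>n. n)"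
  unfolding poly_bounded_def by (rule exI[of _ "[:0, 1:]"]) simp

lemma poly_bounded_add:
  assumes "poly_bounded f" "poly_bounded g" shows "poly_bounded (\<lambda>n. f n + g n)"
  using assms unfolding poly_bounded_def by (metis add_mono poly_add)

lemma poly_bounded_mult:
  assumes "poly_bounded f" "poly_bounded g" shows "poly_bounded (\<lambda>n. f n * g n)"
  using assms unfolding poly_bounded_def by (metis mult_le_mono poly_mult)

lemma poly_nat_mono: "m \<le> n \<Longrightarrow> poly p m \<le> poly p n" for p :: "nat poly"
  by (induction p) (auto intro: mult_le_mono)

text \<open>Natural coefficients make the bounding polynomials monotone, so the bound on the inner
  function can be inserted into the outer polynomial.\<close>

lemma poly_bounded_comp:
  assumes "poly_bounded f" "poly_bounded g" shows "poly_bounded (\<lambda>n. f (g n))"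
  using assms unfolding poly_bounded_def by (metis order_trans poly_nat_mono poly_pcompose)

lemmas poly_bounded_intros =
  poly_bounded_const poly_bounded_id poly_bounded_add poly_bounded_mult

text \<open>\<open>N\<close> is the size of the input. A scalar weight has at most \<open>N\<close>
  digits of \<open>N\<close> bits each, besides the bits of the weights themselves. In
  \<open>N\<close> rounds a distance gains at most \<open>N\<close> bits, each taking two cells.
  There are at most \<open>2 * N\<close> arcs and tokens, one more table entry for the source, and
  \<open>2 * N * (1 + 2 * N)\<close> keys, since a token is paired with a token or the start
  token.\<close>

definition weight_bound :: "nat \<Rightarrow> nat" where "weight_bound N = N + N * N"
definition arc_bound :: "nat \<Rightarrow> nat" where "arc_bound N = 2 + 2 * N + weight_bound N"
definition arcs_bound :: "nat \<Rightarrow> nat" where "arcs_bound N = 2 * N * (1 + arc_bound N)"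
definition entry_bound :: "nat \<Rightarrow> nat" where "entry_bound N = 1 + N + 2 * (weight_bound N + N)"
definition table_bound :: "nat \<Rightarrow> nat" where "table_bound N = (1 + 2 * N) * (1 + entry_bound N)"
definition token_bound :: "nat \<Rightarrow> nat" where "token_bound N = 2 + 2 * N + entry_bound N"
definition tokens_bound :: "nat \<Rightarrow> nat" where "tokens_bound N = 2 * N * (1 + token_bound N)"
definition key_number :: "nat \<Rightarrow> nat" where "key_number N = 2 * N * (1 + 2 * N)"
definition keys_bound :: "nat \<Rightarrow> nat" where
  "keys_bound N = key_number N * (2 + 2 * token_bound N)"
definition path_bound :: "nat \<Rightarrow> nat" where "path_bound N = (2 * N + 1) * (1 + token_bound N)"
definition states_bound :: "nat \<Rightarrow> nat" where
  "states_bound N = (1 + 2 * key_number N) * (2 + 2 * path_bound N)"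

lemmas bound_defs = weight_bound_def arc_bound_def arcs_bound_def entry_bound_def table_bound_def
  token_bound_def tokens_bound_def key_number_def keys_bound_def path_bound_def states_bound_def

definition time_bound :: "nat \<Rightarrow> nat" where
  "time_bound N = 200 + 100 * (1 + N) + 100 * (1 + N) * (1 + N) * (1 + N) +
     (20 + N * (20 + 500 * (1 + 2 * N) * (1 + (1 + 2 * N)) * (1 + arcs_bound N + table_bound N))) +
     1000 * (1 + 2 * N) * (1 + (1 + 2 * N)) * (1 + arcs_bound N + table_bound N) +
     200 * (1 + 2 * N) * (1 + (1 + 2 * N)) * (1 + tokens_bound N) +
     (20 + 2 * N * (20 + 500 * (1 + key_number N) * (1 + (1 + 2 * key_number N)) *
        (1 + keys_bound N + states_bound N))) +
     100 * (1 + (1 + 2 * key_number N)) * (1 + states_bound N)"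

lemma poly_bounded_time_bound: "poly_bounded time_bound"
  unfolding time_bound_def[abs_def] bound_defs by (intro poly_bounded_intros)

section \<open>Sizes of the intermediate values\<close>

lemma size_le_len_mult: "(\<forall>e\<in>set (lst l). size e \<le> b) \<Longrightarrow> size l \<le> len l * (1 + b)"
  by (induction l) auto

lemma size_pad_le: "size (pad w l acc) \<le> size w + len l + size acc"
proof (induction w l acc rule: pad.induct)
  case (2 w u l acc)
  have "size (head w) + size (tail w) \<le> size w" by (cases w) auto
  with 2 show ?case by simp
qed simp

lemma size_scalar_le: "size (scalar ws l acc) \<le> size ws + len ws * len l + size acc"
proof (induction ws l acc rule: scalar.induct)
  case (2 w ws l acc)
  then show ?case using size_pad_le[of w l acc] by simp
qed simp

lemma size_flat: "size (flat x acc) = size x + size acc" "len (flat x acc) = size x + len acc"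
proof -
  have "size ((Dot Null ^^ n) acc) = n + size acc \<and> len ((Dot Null ^^ n) acc) = n + len acc" for n
    by (induction n) auto
  then show "size (flat x acc) = size x + size acc" "len (flat x acc) = size x + len acc"
    by (simp_all add: flat_def)
qed

lemma len_arcs: "len (arcs es l) = 2 * len es"
  by (induction es) (auto simp: Let_def)

lemma arcs_entry_bounds:
  assumes "size es \<le> N" "len l \<le> N" "a \<in> set (lst (arcs es l))"
  shows "size (head a) \<le> N \<and> size (head (tail a)) \<le> N \<and> size (tail (tail a)) \<le> weight_bound N
    \<and> size a \<le> arc_bound N"
  using assms
proof (induction es)
  case (Dot e es)
  let ?w = "scalar (tail (tail e)) l Null"
  have ws: "size (tail (tail e)) \<le> N" and len: "len (tail (tail e)) \<le> N"
    and u: "size (head e) \<le> N" and v: "size (head (tail e)) \<le> N"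
    using Dot.prems(1) size_head_tail_le[of e] size_head_tail_le[of "tail e"]
      len_le_size[of "tail (tail e)"] by auto
  have "size ?w \<le> N + N * N"
    using size_scalar_le[of "tail (tail e)" l Null] mult_le_mono[OF len Dot.prems(2)] ws by simp
  with u v Dot show ?case by (auto simp: Let_def weight_bound_def arc_bound_def)
qed simp

lemma arcs_bounds:
  assumes "size es \<le> N" "len l \<le> N"
  shows "len (arcs es l) \<le> 2 * N" "size (arcs es l) \<le> arcs_bound N"
proof -
  show l: "len (arcs es l) \<le> 2 * N"
    using assms(1) len_le_size[of es] by (simp add: len_arcs)
  have "size (arcs es l) \<le> len (arcs es l) * (1 + arc_bound N)"
    using arcs_entry_bounds[OF assms] by (intro size_le_len_mult) blast
  also have "\<dots> \<le> arcs_bound N" unfolding arcs_bound_def by (rule mult_le_mono1[OF l])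
  finally show "size (arcs es l) \<le> arcs_bound N" .
qed

lemma lookup_in: "lookup k T \<noteq> Null \<Longrightarrow> lookup k T \<in> set (lst T) \<and> head (lookup k T) = k"
  by (induction T) (auto simp: Let_def split: if_splits)

text \<open>The number of digits of a distance is tracked besides its size, because addition
  lengthens it by only one. From a bound on the size alone, \<open>size_add_Null_le\<close> would
  double the bound in every round.\<close>

definition table_ok :: "nat \<Rightarrow> nat \<Rightarrow> val \<Rightarrow> bool" where
  "table_ok N k T \<longleftrightarrow> len T \<le> 1 + 2 * N \<and> (\<forall>e\<in>set (lst T). size (head e) \<le> N \<and>
     len (tail e) \<le> weight_bound N + k \<and> size (tail e) \<le> 2 * (weight_bound N + k) \<and>
     size e \<le> 1 + N + 2 * (weight_bound N + k))"

lemma len_relax_le: "len (relax A T) \<le> len A"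
  by (induction A) (auto simp: Let_def)

lemma relax_entry:
  "e \<in> set (lst (relax A T)) \<longleftrightarrow> (\<exists>a\<in>set (lst A). lookup (head a) T \<noteq> Null \<and>
     e = Dot (head (tail a)) (add (tail (lookup (head a) T)) (tail (tail a)) Null))"
  by (induction A) (auto simp: Let_def)

lemma table_ok_step:
  assumes T: "table_ok N k T" and A: "len A \<le> 2 * N"
    "\<forall>a\<in>set (lst A). size (head (tail a)) \<le> N \<and> size (tail (tail a)) \<le> weight_bound N"
    and s: "size s \<le> N"
  shows "table_ok N (Suc k) (Dot (Dot s Null) (relax A T))"
proof -
  have "size (head e) \<le> N \<and> len (tail e) \<le> weight_bound N + Suc k \<and>
     size (tail e) \<le> 2 * (weight_bound N + Suc k) \<and> size e \<le> 1 + N + 2 * (weight_bound N + Suc k)"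
    if e: "e \<in> set (lst (relax A T))" for e
  proof -
    from e obtain a where a: "a \<in> set (lst A)" and r: "lookup (head a) T \<noteq> Null"
      and e: "e = Dot (head (tail a)) (add (tail (lookup (head a) T)) (tail (tail a)) Null)"
      by (auto simp: relax_entry)
    have "len (tail (lookup (head a) T)) \<le> weight_bound N + k"
      using lookup_in[OF r] T by (auto simp: table_ok_def)
    moreover have "len (tail (tail a)) \<le> weight_bound N"
      using A(2) a len_le_size order_trans by blast
    ultimately show ?thesis
      using A(2) a e size_add_le[of Null "tail (lookup (head a) T)" "tail (tail a)"] by force
  qed
  then show ?thesis using s A(1) len_relax_le[of A T] unfolding table_ok_def by auto
qed

lemma table_ok_size:
  assumes "table_ok N k T" "k \<le> N"
  shows "size T \<le> table_bound N" "\<forall>e\<in>set (lst T). size e \<le> entry_bound N"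
proof -
  show *: "\<forall>e\<in>set (lst T). size e \<le> entry_bound N"
    using assms unfolding table_ok_def entry_bound_def by fastforce
  have "size T \<le> len T * (1 + entry_bound N)" using * by (rule size_le_len_mult)
  also have "\<dots> \<le> table_bound N" unfolding table_bound_def
    by (rule mult_le_mono1) (use assms in \<open>simp add: table_ok_def\<close>)
  finally show "size T \<le> table_bound N" .
qed

lemma dists_bounds:
  assumes A: "len A \<le> 2 * N" "size A \<le> arcs_bound N"
    "\<forall>a\<in>set (lst A). size (head (tail a)) \<le> N \<and> size (tail (tail a)) \<le> weight_bound N"
    and s: "size s \<le> N"
  shows "table_ok N k T \<Longrightarrow> k + len l \<le> N \<Longrightarrow>
    table_ok N (k + len l) (dists l A (Dot s Null) T) \<and>
    dists_cost l A (Dot s Null) T \<le>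
      20 + len l * (20 + 500 * (1 + 2 * N) * (1 + (1 + 2 * N)) * (1 + arcs_bound N + table_bound N))"
proof (induction l arbitrary: k T)
  case (Dot b l)
  have "table_ok N (Suc k) (Dot (Dot s Null) (relax A T))"
    using table_ok_step[OF Dot.prems(1) A(1,3) s] .
  note IH = Dot.IH(2)[OF this]
  have "500 * (1 + len A) * (1 + len T) * (1 + size A + size T) \<le>
    500 * (1 + 2 * N) * (1 + (1 + 2 * N)) * (1 + arcs_bound N + table_bound N)"
    using A Dot.prems table_ok_size(1)[OF Dot.prems(1)]
    by (intro mult_le_mono add_le_mono) (auto simp: table_ok_def)
  with IH Dot.prems show ?case by simp
qed simp

lemma tight_entry:
  "b \<in> set (lst (tight A T)) \<longleftrightarrow> (\<exists>a\<in>set (lst A). lookup (head a) T \<noteq> Null \<and>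
     num (tail (lookup (head a) T)) + num (tail (tail a)) \<le> num (tail (lookup (head (tail a)) T)) \<and>
     b = Dot (head (tail a)) (Dot (head a) (tail (lookup (head (tail a)) T))))"
  by (induction A) (auto simp: Let_def)

lemma len_tight_le: "len (tight A T) \<le> len A"
  by (induction A) (auto simp: Let_def)

lemma partners_entry:
  "k \<in> set (lst (partners a B t fl acc)) \<longleftrightarrow>
     k \<in> set (lst acc) \<or> (\<exists>b\<in>set (lst B). compatible t fl a b \<and> k = Dot a b)"
  by (induction B) auto

lemma keys_entry:
  "k \<in> set (lst (keys A B t fl)) \<longleftrightarrow>
     (\<exists>a\<in>set (lst A). \<exists>b\<in>set (lst B). compatible t fl a b \<and> k = Dot a b)"
  by (induction A) (auto simp: partners_entry)

lemma len_partners_le: "len (partners a B t fl acc) \<le> len B + len acc"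
  by (induction B) auto

lemma len_keys_le: "len (keys A B t fl) \<le> len A * len B"
proof (induction A)
  case (Dot a A)
  then show ?case using len_partners_le[of a B t fl "keys A B t fl"] by simp
qed simp

lemma pick_in: "pick a b S \<noteq> Null \<Longrightarrow> pick a b S \<in> set (lst S) \<and> extends a b (pick a b S)"
  by (induction S) (auto split: if_splits)

lemma move_entry:
  "s \<in> set (lst (move K S)) \<longleftrightarrow> (\<exists>k\<in>set (lst K). pick (head k) (tail k) S \<noteq> Null \<and>
     (s = Dot (Dot (head k) (head (pick (head k) (tail k) S))) (tail (pick (head k) (tail k) S)) \<or>
      s = Dot (tail (pick (head k) (tail k) S)) (Dot (head k) (head (pick (head k) (tail k) S)))))"
  by (induction K) (auto simp: Let_def)

lemma len_move_le: "len (move K S) \<le> 2 * len K"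
  by (induction K) (auto simp: Let_def)

definition states_ok :: "nat \<Rightarrow> nat \<Rightarrow> val \<Rightarrow> bool" where
  "states_ok N k S \<longleftrightarrow> len S \<le> 1 + 2 * key_number N \<and> (\<forall>e\<in>set (lst S).
     size (head e) \<le> (k + 1) * (1 + token_bound N) \<and> size (tail e) \<le> (k + 1) * (1 + token_bound N))"

lemma states_ok_step:
  assumes S: "states_ok N k S" and K: "len K \<le> key_number N"
    "\<forall>a\<in>set (lst K). size (head a) \<le> token_bound N"
    and i: "size i \<le> token_bound N"
  shows "states_ok N (Suc k) (Dot (Dot (Dot i Null) (Dot i Null)) (move K S))"
proof -
  have "size (head e) \<le> (Suc k + 1) * (1 + token_bound N) \<and>
    size (tail e) \<le> (Suc k + 1) * (1 + token_bound N)"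
    if e: "e \<in> set (lst (move K S))" for e
  proof -
    from e obtain a r where a: "a \<in> set (lst K)" and r: "r \<in> set (lst S)"
      and e: "e = Dot (Dot (head a) (head r)) (tail r) \<or> e = Dot (tail r) (Dot (head a) (head r))"
      unfolding move_entry using pick_in by blast
    have "size (head r) \<le> (k + 1) * (1 + token_bound N) \<and> size (tail r) \<le> (k + 1) * (1 + token_bound N)"
      using r S by (auto simp: states_ok_def)
    with e a K(2) show ?thesis by auto
  qed
  then show ?thesis using i K(1) len_move_le[of K S] unfolding states_ok_def by auto
qed

lemma states_ok_size:
  assumes "states_ok N k S" "k \<le> 2 * N" shows "size S \<le> states_bound N"
proof -
  have "size e \<le> 1 + 2 * path_bound N" if "e \<in> set (lst S)" for e
  proof -
    have "(k + 1) * (1 + token_bound N) \<le> path_bound N"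
      unfolding path_bound_def by (rule mult_le_mono1) (use assms in simp)
    moreover have "size e \<le> 1 + size (head e) + size (tail e)" by (cases e) auto
    ultimately show ?thesis using that assms(1) unfolding states_ok_def by fastforce
  qed
  then have "size S \<le> len S * (1 + (1 + 2 * path_bound N))" by (intro size_le_len_mult) blast
  also have "\<dots> \<le> (1 + 2 * key_number N) * (1 + (1 + 2 * path_bound N))"
    by (rule mult_le_mono1) (use assms in \<open>simp add: states_ok_def\<close>)
  finally show ?thesis by (simp add: states_bound_def)
qed

lemma search_bounds:
  assumes K: "len K \<le> key_number N" "size K \<le> keys_bound N"
    "\<forall>a\<in>set (lst K). size (head a) \<le> token_bound N"
    and i: "size i \<le> token_bound N"
  shows "states_ok N k S \<Longrightarrow> k + len l \<le> 2 * N \<Longrightarrow>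
    states_ok N (k + len l) (search l K (Dot (Dot i Null) (Dot i Null)) S) \<and>
    search_cost l K (Dot (Dot i Null) (Dot i Null)) S \<le>
      20 + len l * (20 + 500 * (1 + key_number N) * (1 + (1 + 2 * key_number N)) *
        (1 + keys_bound N + states_bound N))"
proof (induction l arbitrary: k S)
  case (Dot b l)
  have "states_ok N (Suc k) (Dot (Dot (Dot i Null) (Dot i Null)) (move K S))"
    using states_ok_step[OF Dot.prems(1) K(1,3) i] .
  note IH = Dot.IH(2)[OF this]
  have "500 * (1 + len K) * (1 + len S) * (1 + size K + size S) \<le>
    500 * (1 + key_number N) * (1 + (1 + 2 * key_number N)) * (1 + keys_bound N + states_bound N)"
    using K Dot.prems states_ok_size[OF Dot.prems(1)]
    by (intro mult_le_mono add_le_mono) (auto simp: states_ok_def)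
  with IH Dot.prems show ?case by simp
qed simp

theorem main_cost_le: "main_cost fl x \<le> time_bound (size x)"
proof -
  define N where "N = size x"
  let ?es = "head (tail (tail x))" and ?l = "flat x Null"
  have sizes: "size ?es \<le> N" "size (the_source x) \<le> N" and len_l: "len ?l = N"
    unfolding N_def the_source_def
    by (meson size_head_tail_le order_trans)+ (simp add: size_flat)
  have A: "len (the_arcs x) \<le> 2 * N" "size (the_arcs x) \<le> arcs_bound N"
    using arcs_bounds[OF sizes(1), of ?l] len_l by (simp_all add: the_arcs_def)
  have A': "\<forall>a\<in>set (lst (the_arcs x)). size (head a) \<le> N \<and> size (head (tail a)) \<le> N \<and>
      size (tail (tail a)) \<le> weight_bound N"
    using arcs_entry_bounds[OF sizes(1), of ?l] len_l by (simp add: the_arcs_def)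
  have "table_ok N 0 (Dot (Dot (the_source x) Null) Null)"
    using sizes by (simp add: table_ok_def)
  note dists = dists_bounds[OF A _ sizes(2) this, of ?l]
  have T: "table_ok N N (the_dists x)" and
    dists_cost: "dists_cost ?l (the_arcs x) (Dot (the_source x) Null)
       (Dot (Dot (the_source x) Null) Null) \<le>
       20 + N * (20 + 500 * (1 + 2 * N) * (1 + (1 + 2 * N)) * (1 + arcs_bound N + table_bound N))"
    using dists A' len_l by (simp_all add: the_dists_def)
  note T_size = table_ok_size[OF T order_refl]
  have B_len: "len (the_tokens x) \<le> 2 * N"
    using len_tight_le A(1) order_trans unfolding the_tokens_def by blast
  have B: "size b \<le> token_bound N" if b: "b \<in> set (lst (the_tokens x))" for b
  proof -
    obtain a where a: "a \<in> set (lst (the_arcs x))"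
      "b = Dot (head (tail a)) (Dot (head a) (tail (lookup (head (tail a)) (the_dists x))))"
      using b by (auto simp: the_tokens_def tight_entry)
    have "size (tail (lookup (head (tail a)) (the_dists x))) \<le> entry_bound N"
    proof (cases "lookup (head (tail a)) (the_dists x) = Null")
      case False
      then show ?thesis using lookup_in T_size(2) size_head_tail_le(2) order_trans by blast
    qed simp
    moreover have "size (head a) \<le> N" "size (head (tail a)) \<le> N" using A' a(1) by auto
    ultimately show ?thesis using a(2) by (simp add: token_bound_def)
  qed
  have "size (the_tokens x) \<le> len (the_tokens x) * (1 + token_bound N)"
    using B by (intro size_le_len_mult) blast
  also have "\<dots> \<le> tokens_bound N" unfolding tokens_bound_def by (rule mult_le_mono1[OF B_len])
  finally have B_size: "size (the_tokens x) \<le> tokens_bound N" .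
  have start: "size (start_token x) \<le> token_bound N"
    using sizes by (simp add: start_token_def token_bound_def)
  let ?K = "the_keys fl x"
  have "len ?K \<le> len (the_tokens x) * (1 + len (the_tokens x))"
    unfolding the_keys_def using len_keys_le[of "the_tokens x" "Dot (start_token x) (the_tokens x)"]
    by simp
  also have "\<dots> \<le> key_number N"
    unfolding key_number_def using B_len by (intro mult_le_mono) auto
  finally have K_len: "len ?K \<le> key_number N" .
  have K: "size (head k) \<le> token_bound N \<and> size k \<le> 1 + 2 * token_bound N"
    if k: "k \<in> set (lst ?K)" for k
  proof -
    obtain a b where "k = Dot a b" "a \<in> set (lst (the_tokens x))"
      "b = start_token x \<or> b \<in> set (lst (the_tokens x))"
      using k by (auto simp: the_keys_def keys_entry)
    then have "k = Dot a b" "size a \<le> token_bound N" "size b \<le> token_bound N"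
      using B start by auto
    then show ?thesis by simp
  qed
  have "size ?K \<le> len ?K * (1 + (1 + 2 * token_bound N))"
    using K by (intro size_le_len_mult) blast
  also have "\<dots> \<le> key_number N * (1 + (1 + 2 * token_bound N))" by (rule mult_le_mono1[OF K_len])
  finally have K_size: "size ?K \<le> keys_bound N" by (simp add: keys_bound_def)
  have "states_ok N 0 (Dot (start_state x) Null)"
    using start by (simp add: states_ok_def start_state_def)
  note search = search_bounds[OF K_len K_size _ start this, of "flat x ?l"]
  have S: "states_ok N (2 * N) (the_states fl x)" and
    search_cost: "search_cost (flat x ?l) ?K (start_state x) (Dot (start_state x) Null) \<le>
      20 + 2 * N * (20 + 500 * (1 + key_number N) * (1 + (1 + 2 * key_number N)) *
        (1 + keys_bound N + states_bound N))"
    using search K len_l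
    by (simp_all add: the_states_def start_state_def size_flat N_def mult_2)
  note S_size = states_ok_size[OF S order_refl]
  have "arcs_cost ?es ?l \<le> 100 * (1 + N) * (1 + N) * (1 + N)"
    unfolding arcs_cost_def using sizes(1) len_le_size[of ?es]
    by (intro mult_le_mono add_le_mono) (auto simp: size_flat N_def)
  moreover have "tight_cost (the_arcs x) (the_dists x) \<le>
    1000 * (1 + 2 * N) * (1 + (1 + 2 * N)) * (1 + arcs_bound N + table_bound N)"
    unfolding tight_cost_def using A T T_size(1)
    by (intro mult_le_mono add_le_mono) (auto simp: table_ok_def)
  moreover have "keys_cost (the_tokens x) (Dot (start_token x) (the_tokens x)) \<le>
    200 * (1 + 2 * N) * (1 + (1 + 2 * N)) * (1 + tokens_bound N)"
    unfolding keys_cost_def using B_len B_size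
    by (intro mult_le_mono add_le_mono) auto
  moreover have "finish_cost (the_states fl x) \<le>
    100 * (1 + (1 + 2 * key_number N)) * (1 + states_bound N)"
    unfolding finish_cost_def using S S_size
    by (intro mult_le_mono add_le_mono) (auto simp: states_ok_def)
  ultimately show ?thesis
    using dists_cost search_cost unfolding main_cost_def time_bound_def N_def[symmetric] by linarith
qed


section \<open>Encodings, scalarised weights and tight edges\<close>

lemma lst_inj: "lst x = lst y \<Longrightarrow> x = y"
proof (induction x arbitrary: y)
  case Null
  then show ?case by (cases y) auto
next
  case (Dot a x)
  then show ?case by (cases y) auto
qed

lemma lst_enc_list [simp]: "lst (enc_list f xs) = map f xs"
  by (induction xs) (auto simp: enc_list_def)

lemma enc_list_simps [simp]:
  "enc_list f [] = Null" "enc_list f (x # xs) = Dot (f x) (enc_list f xs)"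
  by (simp_all add: enc_list_def)

lemma size_enc_list: "size (enc_list f xs) = (\<Sum>x\<leftarrow>xs. 1 + size (f x))"
  by (induction xs) auto

lemma num_enc_nat [simp]: "num (enc_nat n) = n"
proof (induction n rule: bits.induct)
  case (1 n)
  then show ?case
    by (subst enc_nat_def, subst bits.simps) (auto simp: enc_nat_def)
qed

lemma enc_nat_inject [simp]: "enc_nat m = enc_nat n \<longleftrightarrow> m = n"
  by (metis num_enc_nat)

lemma len_enc_nat: "len (enc_nat n) = bit_length n"
  by (simp add: enc_nat_def bit_length_def)

lemma size_enc_nat_le: "size (enc_nat n) \<le> 2 * bit_length n"
proof -
  have "size (enc_list enc_bool bs) \<le> 2 * length bs" for bs
    by (induction bs) (auto simp: enc_bool_def)
  then show ?thesis by (simp add: enc_nat_def bit_length_def)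
qed

lemma bit_length_le: "bit_length n \<le> n"
proof (induction n rule: bits.induct)
  case (1 n)
  then show ?case by (subst bit_length_def, subst bits.simps) (auto simp: bit_length_def)
qed

lemma num_less: "num x < 2 ^ len x"
  by (induction x) (auto simp: of_bool_def)

lemma less_exp_bit_length: "n < 2 ^ bit_length n"
  by (metis len_enc_nat num_enc_nat num_less)

lemma num_pad: "len w \<le> len l \<Longrightarrow> num (pad w l acc) = num w + 2 ^ len l * num acc"
proof (induction w l acc rule: pad.induct)
  case (1 w acc)
  then show ?case by (cases w) auto
next
  case (2 w u l acc)
  then show ?case by (cases w) auto
qed

section \<open>Horner evaluation and the lexicographic order\<close>

fun horner :: "nat \<Rightarrow> nat \<Rightarrow> nat list \<Rightarrow> nat" where
  "horner b a [] = a"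
| "horner b a (w # ws) = horner b (w + b * a) ws"

lemma num_scalar:
  "\<forall>w\<in>set ws. bit_length w \<le> len l \<Longrightarrow>
     num (scalar (enc_list enc_nat ws) l acc) = horner (2 ^ len l) (num acc) ws"
  by (induction ws arbitrary: acc) (auto simp: num_pad len_enc_nat)

text \<open>Horner evaluation is linear in the start value and the digits together, whether or not
  the digits are below the base. Hence evaluating the cost vector of a path gives the sum of the
  scalar weights of its edges.\<close>

lemma horner_sum:
  "horner b (\<Sum>e\<in>S. a e) (map (\<lambda>i. \<Sum>e\<in>S. g e i) is) = (\<Sum>e\<in>S. horner b (a e) (map (g e) is))"
proof (induction "is" arbitrary: a)
  case (Cons i "is")
  have "(\<Sum>e\<in>S. g e i) + b * (\<Sum>e\<in>S. a e) = (\<Sum>e\<in>S. g e i + b * a e)"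
    by (simp add: sum.distrib sum_distrib_left)
  then show ?case using Cons.IH[of "\<lambda>e. g e i + b * a e"] by simp
qed simp

text \<open>A lead in the more significant digits cannot be made up: with \<open>x < b\<close>, the
  value \<open>x + b * a\<close> stays below \<open>b * (a + 1)\<close>, which is at most
  \<open>b * c\<close>.\<close>

lemma horner_less:
  assumes "length xs = length ys" "\<forall>x\<in>set xs. x < b" "a < c"
  shows "horner b a xs < horner b c ys"
  using assms
proof (induction xs ys arbitrary: a c rule: list_induct2)
  case (Cons x xs y ys)
  have "x + b * a < b * (a + 1)" using Cons.prems by simp
  also have "\<dots> \<le> b * c" using Cons.prems by (intro mult_le_mono) auto
  finally show ?case using Cons by simp
qed simp

lemma lex_iff_horner_less:
  assumes "length xs = length ys" "\<forall>x\<in>set xs. x < b" "\<forall>y\<in>set ys. y < b"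
  shows "(xs, ys) \<in> lex less_than \<longleftrightarrow> horner b a xs < horner b a ys"
  using assms
proof (induction xs ys arbitrary: a rule: list_induct2)
  case (Cons x xs y ys)
  consider "x < y" | "x = y" | "y < x" by linarith
  then show ?case
  proof cases
    case 1
    then have "horner b (x + b * a) xs < horner b (y + b * a) ys"
      using Cons.prems Cons.hyps by (intro horner_less) auto
    with 1 Cons.hyps show ?thesis by simp
  next
    case 2
    with Cons.IH[of "x + b * a"] Cons.prems show ?thesis by simp
  next
    case 3
    then have "horner b (y + b * a) ys < horner b (x + b * a) xs"
      using Cons.prems Cons.hyps by (intro horner_less) auto
    with 3 show ?thesis by simp
  qed
qed simp

lemma horner_pos:
  assumes "0 < b" shows "a > 0 \<or> (\<exists>w\<in>set ws. w > 0) \<Longrightarrow> horner b a ws > 0"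
proof (induction ws arbitrary: a)
  case (Cons w ws)
  then have "w + b * a > 0 \<or> (\<exists>w\<in>set ws. w > 0)" using assms by auto
  then show ?case using Cons.IH by simp
qed simp

text \<open>As the product of \<open>a + 1\<close> and \<open>b + 1\<close> exceeds
  \<open>a + b\<close>, summing numbers at most adds up their bit lengths. This yields a base above
  all path costs without computing any cost.\<close>

lemma sum_less_exp_sum:
  fixes f g :: "'a \<Rightarrow> nat"
  assumes "finite S" "\<forall>e\<in>S. f e < 2 ^ g e"
  shows "(\<Sum>e\<in>S. f e) < 2 ^ (\<Sum>e\<in>S. g e)"
  using assms
proof (induction S)
  case (insert e S)
  have "f e + 1 \<le> 2 ^ g e" "(\<Sum>e\<in>S. f e) + 1 \<le> 2 ^ (\<Sum>e\<in>S. g e)" using insert by auto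
  from mult_le_mono[OF this] show ?case using insert by (simp add: power_add algebra_simps)
qed simp

section \<open>Edge sets of paths\<close>

lemma path_edges_simps [simp]:
  "path_edges [] = {}" "path_edges [v] = {}"
  "path_edges (u # v # P) = insert {u, v} (path_edges (v # P))"
  by (auto simp: path_edges_def)

lemma path_edges_subset_Pow: "e \<in> path_edges P \<Longrightarrow> e \<subseteq> set P"
  by (induction P rule: induct_list012) auto

lemma finite_path_edges [simp]: "finite (path_edges P)"
  by (simp add: path_edges_def)

lemma path_edges_snoc:
  "P \<noteq> [] \<Longrightarrow> path_edges (P @ [v]) = insert {last P, v} (path_edges P)"
  by (induction P rule: induct_list012) auto

lemma path_edges_iff_successively:
  "successively (\<lambda>u v. {u, v} \<in> E) P \<longleftrightarrow> path_edges P \<subseteq> E"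
  by (induction P rule: induct_list012) auto

section \<open>Shortest walks and tight edges for positive scalar weights\<close>

locale weighted_graph =
  fixes E :: "'v set set" and wt :: "'v set \<Rightarrow> nat" and s :: 'v
  assumes wt_pos: "e \<in> E \<Longrightarrow> 0 < wt e"
    and finite_E: "finite E"
    and edge_card: "e \<in> E \<Longrightarrow> finite e \<and> card e \<le> 2"
begin

text \<open>\<open>walk k v c\<close>: some walk from \<open>s\<close> to \<open>v\<close> has at most \<open>k\<close> edges and cost \<open>c\<close>.\<close>

inductive walk :: "nat \<Rightarrow> 'v \<Rightarrow> nat \<Rightarrow> bool" where
  walk_start: "walk k s 0"
| walk_step: "walk k u c \<Longrightarrow> {u, v} \<in> E \<Longrightarrow> walk (Suc k) v (c + wt {u, v})"

definition reachable :: "'v \<Rightarrow> bool" where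
  "reachable v \<longleftrightarrow> (\<exists>k c. walk k v c)"

text \<open>For an unreachable node the value is unspecified, which is why \<open>tight_edge\<close>
  demands a reachable tail.\<close>

definition D :: "'v \<Rightarrow> nat" where
  "D v = (LEAST c. \<exists>k. walk k v c)"

text \<open>The inequality is what the program tests; the triangle inequality \<open>D_step\<close>
  turns it into an equation.\<close>

definition tight_edge :: "'v \<Rightarrow> 'v \<Rightarrow> bool" where
  "tight_edge u v \<longleftrightarrow> reachable u \<and> {u, v} \<in> E \<and> D u + wt {u, v} \<le> D v"

lemma walk_D: "reachable v \<Longrightarrow> \<exists>k. walk k v (D v)"
  unfolding D_def reachable_def by (rule LeastI_ex) blast

lemma D_le: "walk k v c \<Longrightarrow> D v \<le> c"
  unfolding D_def by (rule Least_le) blast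

lemma D_s [simp]: "D s = 0"
  using D_le[OF walk_start] by simp

lemma reachable_s [simp]: "reachable s"
  using walk_start reachable_def by blast

lemma reachable_step: "reachable u \<Longrightarrow> {u, v} \<in> E \<Longrightarrow> reachable v"
  unfolding reachable_def using walk_step by blast

lemma D_step: "reachable u \<Longrightarrow> {u, v} \<in> E \<Longrightarrow> D v \<le> D u + wt {u, v}"
  using walk_D walk_step D_le by blast

lemma tight_edge_eq: "tight_edge u v \<Longrightarrow> D v = D u + wt {u, v}"
  using D_step[of u v] unfolding tight_edge_def by simp

lemma tight_edge_less: "tight_edge u v \<Longrightarrow> D u < D v"
  using wt_pos[of "{u, v}"] by (auto simp: tight_edge_def)

lemma tight_edge_in_E: "tight_edge u v \<Longrightarrow> {u, v} \<in> E"
  by (simp add: tight_edge_def)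

text \<open>The last edge of a cheapest walk to \<open>v\<close> is tight, and its other end has
  smaller \<open>D\<close>, so induction on \<open>D v\<close> applies.\<close>

lemma tight_path_exists:
  "reachable v \<Longrightarrow> \<exists>P. P \<noteq> [] \<and> hd P = s \<and> last P = v \<and> successively tight_edge P"
proof (induction "D v" arbitrary: v rule: less_induct)
  case less
  obtain k where "walk k v (D v)" using walk_D[OF less.prems] by blast
  then show ?case
  proof cases
    case walk_start
    then show ?thesis by (intro exI[of _ "[s]"]) auto
  next
    case (walk_step k' u c)
    have u: "reachable u" using walk_step reachable_def by blast
    have tight: "tight_edge u v"
      using D_le[OF walk_step(3)] walk_step u by (simp add: tight_edge_def)
    obtain P where P: "P \<noteq> []" "hd P = s" "last P = u" "successively tight_edge P"
      using less.hyps[OF tight_edge_less[OF tight] u] by blast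
    with tight show ?thesis
      by (intro exI[of _ "P @ [v]"]) (auto simp: successively_append_iff)
  qed
qed

lemma tight_path_mono:
  "successively tight_edge P \<Longrightarrow> sorted_wrt (\<lambda>u v. D u < D v) P"
  by (induction P rule: induct_list012) (auto dest!: tight_edge_less intro: less_trans)

lemma tight_path_distinct:
  assumes "successively tight_edge P" shows "distinct P"
proof -
  have "sorted_wrt (<) (map D P)"
    using tight_path_mono[OF assms] by (simp add: sorted_wrt_map)
  then show ?thesis by (simp add: strict_sorted_iff distinct_map)
qed

lemma tight_path_tl_subset: "successively tight_edge P \<Longrightarrow> set (tl P) \<subseteq> \<Union> E"
  by (induction P rule: induct_list012) (auto dest: tight_edge_in_E)

text \<open>All nodes but the first are ends of edges. Counting edges instead of nodes matters
  because the input contains the number of nodes only in binary, so its size need not bound that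
  number, whereas all edges are listed.\<close>

lemma tight_path_length:
  assumes "successively tight_edge P" shows "length P \<le> 1 + 2 * card E"
proof -
  have "length (tl P) = card (set (tl P))"
    using tight_path_distinct[OF assms] by (simp add: distinct_card distinct_tl)
  also have "\<dots> \<le> card (\<Union> E)"
    using finite_E edge_card tight_path_tl_subset[OF assms] by (intro card_mono) auto
  also have "\<dots> \<le> (\<Sum>e\<in>E. card e)" by (rule card_Union_le_sum_card)
  also have "\<dots> \<le> (\<Sum>e\<in>E. 2)" using edge_card by (intro sum_mono) auto
  finally show ?thesis by simp
qed

lemma walk_tight_path:
  "successively tight_edge P \<Longrightarrow> P \<noteq> [] \<Longrightarrow> hd P = s \<Longrightarrow> length P \<le> Suc k \<Longrightarrow>
     walk k (last P) (D (last P))"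
proof (induction P arbitrary: k rule: rev_induct)
  case (snoc v P)
  show ?case
  proof (cases "P = []")
    case True
    then show ?thesis using snoc walk_start[of k] by simp
  next
    case False
    obtain k' where k: "k = Suc k'" using snoc.prems(4) False by (cases k) auto
    have "walk k' (last P) (D (last P))"
      using snoc False k by (auto simp: successively_append_iff)
    moreover have "tight_edge (last P) v" using snoc.prems(1) False by (auto simp: successively_append_iff)
    ultimately show ?thesis
      using walk_step[of k' "last P" _ v] tight_edge_in_E tight_edge_eq k by simp
  qed
qed simp

lemma walk_D_bounded:
  assumes "reachable v" "2 * card E \<le> k" shows "walk k v (D v)"
proof -
  obtain P where P: "P \<noteq> []" "hd P = s" "last P = v" "successively tight_edge P"
    using tight_path_exists[OF assms(1)] by blast
  then have "length P \<le> Suc k" using tight_path_length[OF P(4)] assms(2) by simp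
  then show ?thesis using walk_tight_path[of P k] P by simp
qed

definition path_wt :: "'v list \<Rightarrow> nat" where
  "path_wt P = (\<Sum>e\<in>path_edges P. wt e)"

text \<open>The weight is a sum over a set of edges; it grows by the new edge because that edge
  contains the fresh node \<open>v\<close>.\<close>

lemma path_wt_snoc:
  assumes "P \<noteq> []" "distinct (P @ [v])"
  shows "path_wt (P @ [v]) = path_wt P + wt {last P, v}"
proof -
  have "{last P, v} \<notin> path_edges P" using path_edges_subset_Pow assms by fastforce
  then show ?thesis using assms by (simp add: path_wt_def path_edges_snoc)
qed

text \<open>Starting from \<open>D s = 0\<close>, every edge raises \<open>D\<close> by at most its
  weight. Equality at the end therefore forces equality at each edge, which is tightness.\<close>

lemma path_wt_ge_D:
  "P \<noteq> [] \<Longrightarrow> hd P = s \<Longrightarrow> distinct P \<Longrightarrow> successively (\<lambda>u v. {u, v} \<in> E) P \<Longrightarrow>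
     reachable (last P) \<and> D (last P) \<le> path_wt P \<and>
     (D (last P) = path_wt P \<longleftrightarrow> successively tight_edge P)"
proof (induction P rule: rev_induct)
  case (snoc v P)
  show ?case
  proof (cases "P = []")
    case True
    then show ?thesis using snoc by (auto simp: path_wt_def)
  next
    case False
    have E: "{last P, v} \<in> E" using snoc.prems(4) False by (auto simp: successively_append_iff)
    have IH: "reachable (last P)" "D (last P) \<le> path_wt P"
      "D (last P) = path_wt P \<longleftrightarrow> successively tight_edge P"
      using snoc False by (auto simp: successively_append_iff)
    have "successively tight_edge (P @ [v]) \<longleftrightarrow> successively tight_edge P \<and> tight_edge (last P) v"
      using False by (auto simp: successively_append_iff)
    moreover have "tight_edge (last P) v \<longleftrightarrow> D v = D (last P) + wt {last P, v}"
      using D_step[OF IH(1) E] E IH(1) by (auto simp: tight_edge_def)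
    moreover have "path_wt (P @ [v]) = path_wt P + wt {last P, v}"
      using path_wt_snoc False snoc.prems(3) by blast
    moreover have "D v = path_wt P + wt {last P, v} \<longleftrightarrow>
      D (last P) = path_wt P \<and> D v = D (last P) + wt {last P, v}"
      using D_step[OF IH(1) E] IH(2) by linarith
    ultimately show ?thesis
      using D_step[OF IH(1) E] reachable_step[OF IH(1) E] IH by simp
  qed
qed simp

end


section \<open>Distances computed by the program\<close>

lemma arcs_entry:
  "a \<in> set (lst (arcs es l)) \<longleftrightarrow> (\<exists>e\<in>set (lst es).
     a = Dot (head e) (Dot (head (tail e)) (scalar (tail (tail e)) l Null)) \<or>
     a = Dot (head (tail e)) (Dot (head e) (scalar (tail (tail e)) l Null)))"
  by (induction es) (auto simp: Let_def)

lemma lookup_min: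
  assumes "\<forall>e\<in>set (lst T). e \<noteq> Null" "e \<in> set (lst T)" "head e = k"
  shows "lookup k T \<noteq> Null \<and> num (tail (lookup k T)) \<le> num (tail e)"
  using assms
proof (induction T)
  case (Dot f T)
  then show ?case
    by (cases "e \<in> set (lst T)") (auto simp: Let_def)
qed simp

section \<open>Encoded instances and their sizes\<close>

locale encoded_instance =
  fixes I :: "nat mc_instance" and n :: nat and es :: "(nat \<times> nat) list" and x :: val
  assumes valid: "valid_instance I"
    and nodes_eq: "nodes I = {..<n}"
    and distinct_edges: "distinct (map (\<lambda>(u, v). {u, v}) es)"
    and edges_eq: "edges I = (\<lambda>(u, v). {u, v}) ` set es"
    and x_eq: "x = enc_pair enc_nat
              (enc_pair enc_nat
                (enc_pair
                  (enc_list (enc_pair enc_nat (enc_pair enc_nat (enc_list enc_nat))))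
                  (enc_pair enc_nat enc_nat)))
              (n, criteria I,
               map (\<lambda>(u, v). (u, v, map (weight I {u, v}) [1..<Suc (criteria I)])) es,
               source I, target I)"
begin

abbreviation ws :: "nat set \<Rightarrow> nat list" where
  "ws e \<equiv> map (weight I e) [1..<Suc (criteria I)]"

definition edge_val :: "nat \<times> nat \<Rightarrow> val" where
  "edge_val = (\<lambda>(u, v). Dot (enc_nat u) (Dot (enc_nat v) (enc_list enc_nat (ws {u, v}))))"

lemma x_Dot: "x = Dot (enc_nat n) (Dot (enc_nat (criteria I))
    (Dot (enc_list edge_val es) (Dot (enc_nat (source I)) (enc_nat (target I)))))"
proof -
  have "enc_list (enc_pair enc_nat (enc_pair enc_nat (enc_list enc_nat)))
     (map (\<lambda>(u, v). (u, v, map (weight I {u, v}) [1..<Suc (criteria I)])) es) = enc_list edge_val es"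
    by (rule lst_inj) (auto simp: enc_pair_def edge_val_def)
  then show ?thesis unfolding x_eq by (simp add: enc_pair_def)
qed

lemma the_source_eq: "the_source x = enc_nat (source I)"
  and the_target_eq: "the_target x = enc_nat (target I)"
  by (simp_all add: the_source_def the_target_def x_Dot)

lemma sum_edges: "(\<Sum>e\<in>edges I. f e) = (\<Sum>(u, v)\<leftarrow>es. f {u, v})" for f :: "nat set \<Rightarrow> nat"
proof -
  have "edges I = set (map (\<lambda>(u, v). {u, v}) es)" by (simp add: edges_eq)
  then have "(\<Sum>e\<in>edges I. f e) = sum_list (map f (map (\<lambda>(u, v). {u, v}) es))"
    by (simp only: sum.distinct_set_conv_list[OF distinct_edges])
  also have "map f (map (\<lambda>(u, v). {u, v}) es) = map (\<lambda>(u, v). f {u, v}) es" by auto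
  finally show ?thesis .
qed

lemma edge_iff: "{u, v} \<in> edges I \<longleftrightarrow> (u, v) \<in> set es \<or> (v, u) \<in> set es"
  unfolding edges_eq by (auto simp: doubleton_eq_iff)

lemma edge_nodes: "{u, v} \<in> edges I \<Longrightarrow> u < n \<and> v < n \<and> u \<noteq> v"
  using valid nodes_eq by (fastforce simp: valid_instance_def doubleton_eq_iff)

lemma weight_pos: "e \<in> edges I \<Longrightarrow> w \<in> set (ws e) \<Longrightarrow> 0 < w"
  using valid by (auto simp: valid_instance_def)

lemma size_edge_val:
  "size (edge_val (u, v)) =
    2 + size (enc_nat u) + size (enc_nat v) + (criteria I + (\<Sum>i\<in>{1..criteria I}. size (enc_nat (weight I {u, v} i))))"
proof -
  have "size (enc_list enc_nat (ws {u, v})) = (\<Sum>i\<leftarrow>[1..<Suc (criteria I)]. 1 + size (enc_nat (weight I {u, v} i)))"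
    by (simp add: size_enc_list o_def del: upt_Suc)
  also have "\<dots> = (\<Sum>i\<in>{1..criteria I}. 1 + size (enc_nat (weight I {u, v} i)))"
    by (subst interv_sum_list_conv_sum_set_nat) (simp add: atLeastLessThanSuc_atLeastAtMost del: upt_Suc)
  also have "\<dots> = criteria I + (\<Sum>i\<in>{1..criteria I}. size (enc_nat (weight I {u, v} i)))"
    by (simp only: sum.distrib) simp
  finally show ?thesis by (simp add: edge_val_def del: upt_Suc)
qed

lemma size_edges: "size (enc_list edge_val es) = (\<Sum>p\<leftarrow>es. 1 + size (edge_val p))"
  by (rule size_enc_list)

lemma card_edges: "card (edges I) = length es"
  using sum_edges[of "\<lambda>_. 1"] by (simp add: case_prod_unfold sum_list_triv)

text \<open>An edge takes at least three cells: its list cell and the two that join its ends and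
  weights. So the clock \<open>size x\<close> is at least \<open>2 * card (edges I)\<close>, the
  number of rounds that Bellman-Ford needs.\<close>

lemma card_edges_le: "3 * card (edges I) \<le> size x"
proof -
  have "(\<Sum>p\<leftarrow>es. 3) \<le> (\<Sum>p\<leftarrow>es. 1 + size (edge_val p))"
    by (rule sum_list_mono) (auto simp: size_edge_val)
  then show ?thesis by (simp add: card_edges x_Dot size_edges sum_list_triv)
qed

text \<open>The weights are spelled out bit by bit in the input. This makes its size a sufficient
  digit width for the costs of all paths.\<close>

lemma sum_bits_le:
  assumes "i \<in> {1..criteria I}"
  shows "(\<Sum>e\<in>edges I. bit_length (weight I e i)) \<le> size x"
proof -
  have "(\<Sum>e\<in>edges I. bit_length (weight I e i)) \<le> (\<Sum>p\<leftarrow>es. 1 + size (edge_val p))"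
    unfolding sum_edges
  proof (rule sum_list_mono, clarify)
    fix u v
    have "bit_length (weight I {u, v} i) \<le> size (enc_nat (weight I {u, v} i))"
      by (metis len_enc_nat len_le_size)
    also have "\<dots> \<le> (\<Sum>i\<in>{1..criteria I}. size (enc_nat (weight I {u, v} i)))"
      using assms by (intro member_le_sum) auto
    finally show "bit_length (weight I {u, v} i) \<le> 1 + size (edge_val (u, v))"
      by (simp add: size_edge_val)
  qed
  then show ?thesis by (simp add: x_Dot size_edges)
qed

lemma finite_edges: "finite (edges I)"
  by (simp add: edges_eq)

lemma bit_length_weight_le:
  assumes "e \<in> edges I" "i \<in> {1..criteria I}" shows "bit_length (weight I e i) \<le> size x"
proof -
  have "bit_length (weight I e i) \<le> (\<Sum>e\<in>edges I. bit_length (weight I e i))"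
    by (rule member_le_sum[OF assms(1)]) (auto simp: finite_edges)
  with sum_bits_le[OF assms(2)] show ?thesis by simp
qed

text \<open>With \<open>M\<close> the instance size, the frame has 4 cells and four numbers of size
  at most \<open>2 * M\<close>. Each of at most \<open>M\<close> edges has 3 cells, two ends of size
  \<open>2 * M\<close> and \<open>criteria I\<close> list cells. The weights themselves take two
  cells per bit.\<close>

lemma size_x_le:
  "size x \<le> 4 + 8 * instance_size I + instance_size I * (3 + 5 * instance_size I) + 2 * instance_size I"
proof -
  define M where "M = instance_size I"
  have M: "n \<le> M" "length es \<le> M" "criteria I \<le> M"
    "(\<Sum>e\<in>edges I. \<Sum>i\<in>{1..criteria I}. bit_length (weight I e i)) \<le> M"
    unfolding M_def instance_size_def by (auto simp: nodes_eq card_edges)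
  have enc: "size (enc_nat k) \<le> 2 * M" if "k \<le> M" for k
    using size_enc_nat_le[of k] bit_length_le[of k] that by simp
  have "1 + size (edge_val (u, v)) \<le>
    (3 + 5 * M) + 2 * (\<Sum>i\<in>{1..criteria I}. bit_length (weight I {u, v} i))"
    if "(u, v) \<in> set es" for u v
  proof -
    have "size (enc_nat u) \<le> 2 * M" "size (enc_nat v) \<le> 2 * M"
      using edge_nodes[of u v] that M(1) by (auto intro!: enc simp: edge_iff)
    moreover have "(\<Sum>i\<in>{1..criteria I}. size (enc_nat (weight I {u, v} i))) \<le>
      (\<Sum>i\<in>{1..criteria I}. 2 * bit_length (weight I {u, v} i))"
      by (intro sum_mono size_enc_nat_le)
    ultimately show ?thesis using M(3) by (simp add: size_edge_val sum_distrib_left)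
  qed
  then have "(\<Sum>p\<leftarrow>es. 1 + size (edge_val p)) \<le> (\<Sum>(u, v)\<leftarrow>es. (3 + 5 * M) +
     2 * (\<Sum>i\<in>{1..criteria I}. bit_length (weight I {u, v} i)))"
    by (intro sum_list_mono) auto
  also have "\<dots> = length es * (3 + 5 * M) +
      2 * (\<Sum>e\<in>edges I. \<Sum>i\<in>{1..criteria I}. bit_length (weight I e i))"
    unfolding sum_edges
    by (simp add: case_prod_unfold sum_list_addf sum_list_triv sum_list_const_mult distrib_left)
  also have "\<dots> \<le> M * (3 + 5 * M) + 2 * M"
    using M by (intro add_le_mono mult_le_mono) auto
  finally have "size (enc_list edge_val es) \<le> M * (3 + 5 * M) + 2 * M" by (simp add: size_edges)
  moreover have "source I < n" "target I < n"
    using valid by (auto simp: valid_instance_def nodes_eq)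
  then have "size (enc_nat (source I)) \<le> 2 * M" "size (enc_nat (target I)) \<le> 2 * M"
    using M(1) by (auto intro!: enc)
  moreover have "size (enc_nat n) \<le> 2 * M" "size (enc_nat (criteria I)) \<le> 2 * M"
    using M by (auto intro!: enc)
  ultimately show ?thesis unfolding M_def[symmetric] x_Dot by simp
qed

section \<open>Scalar weights and the shortest paths of the instance\<close>

definition wt :: "nat set \<Rightarrow> nat" where
  "wt e = horner (2 ^ size x) 0 (ws e)"

end

sublocale encoded_instance \<subseteq> weighted_graph "edges I" wt "source I"
proof
  fix e assume e: "e \<in> edges I"
  have "1 \<in> {1..criteria I}" using valid by (simp add: valid_instance_def)
  then have "\<exists>w\<in>set (ws e). 0 < w" using weight_pos[OF e] by force
  then show "0 < wt e" unfolding wt_def by (intro horner_pos) auto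
  obtain u v where "e = {u, v}" using e by (auto simp: edges_eq)
  then show "finite e \<and> card e \<le> 2" by (auto simp: card_insert_if)
qed (rule finite_edges)

context encoded_instance
begin

lemma path_cost_less:
  assumes "path_edges P \<subseteq> edges I" "i \<in> {1..criteria I}"
  shows "path_cost I i P < 2 ^ size x"
proof -
  have "path_cost I i P \<le> (\<Sum>e\<in>edges I. weight I e i)"
    unfolding path_cost_def by (rule sum_mono2[OF finite_edges assms(1)]) simp
  also have "\<dots> < 2 ^ (\<Sum>e\<in>edges I. bit_length (weight I e i))"
    by (rule sum_less_exp_sum[OF finite_edges]) (simp add: less_exp_bit_length)
  also have "\<dots> \<le> 2 ^ size x" using sum_bits_le[OF assms(2)] by (simp add: power_increasing)
  finally show ?thesis .
qed

lemma path_wt_eq: "path_wt P = horner (2 ^ size x) 0 (cost_vector I P)"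
  using horner_sum[of "2 ^ size x" "\<lambda>_. 0" "path_edges P" "weight I" "[1..<Suc (criteria I)]"]
  unfolding path_wt_def wt_def cost_vector_def path_cost_def by simp

lemma shorter_iff:
  assumes "path_edges P \<subseteq> edges I" "path_edges P' \<subseteq> edges I"
  shows "shorter I P P' \<longleftrightarrow> path_wt P < path_wt P'"
  unfolding shorter_def path_wt_eq
  using path_cost_less[OF assms(1)] path_cost_less[OF assms(2)]
  by (intro lex_iff_horner_less) (auto simp: cost_vector_def simp del: upt_Suc)

lemma tight_st_path:
  assumes "P \<noteq> []" "hd P = source I" "last P = target I" "successively tight_edge P"
  shows "st_path I P" "path_edges P \<subseteq> edges I" "path_wt P = D (target I)"
proof -
  have succ: "successively (\<lambda>u v. {u, v} \<in> edges I) P"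
    using assms(4) by (rule successively_mono) (auto dest: tight_edge_in_E)
  have "\<Union> (edges I) \<subseteq> nodes I" using valid by (auto simp: valid_instance_def)
  then have "set (tl P) \<subseteq> nodes I" using tight_path_tl_subset[OF assms(4)] by blast
  moreover have "set P = insert (hd P) (set (tl P))" using assms(1) by (cases P) auto
  ultimately have "set P \<subseteq> nodes I" using assms(2) valid by (auto simp: valid_instance_def)
  then show "st_path I P"
    using assms succ tight_path_distinct[OF assms(4)] by (simp add: st_path_def)
  show "path_edges P \<subseteq> edges I" using succ by (simp add: path_edges_iff_successively)
  show "path_wt P = D (target I)"
    using path_wt_ge_D[OF assms(1,2) tight_path_distinct[OF assms(4)] succ] assms by simp
qed

lemma st_path_wt:
  assumes "st_path I P"
  shows "path_edges P \<subseteq> edges I" "reachable (target I)" "D (target I) \<le> path_wt P"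
    "D (target I) = path_wt P \<longleftrightarrow> successively tight_edge P"
  using assms path_wt_ge_D[of P] by (auto simp: st_path_def path_edges_iff_successively)

text \<open>\<open>D\<close> minimises over walks, while shortest paths compete only with simple
  paths. A tight path to the target closes the gap: it attains \<open>D\<close> and is simple
  because \<open>D\<close> increases along it.\<close>

theorem shortest_iff_tight:
  "shortest_st_path I P \<longleftrightarrow>
     P \<noteq> [] \<and> hd P = source I \<and> last P = target I \<and> successively tight_edge P"
proof
  assume P: "shortest_st_path I P"
  then have st: "st_path I P" by (simp add: shortest_st_path_def)
  note wt = st_path_wt[OF st]
  obtain P' where P': "P' \<noteq> []" "hd P' = source I" "last P' = target I" "successively tight_edge P'"
    using tight_path_exists[OF wt(2)] by blast
  have "\<not> shorter I P' P" using P tight_st_path(1)[OF P'] by (auto simp: shortest_st_path_def)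
  then have "path_wt P \<le> D (target I)"
    using shorter_iff[OF tight_st_path(2)[OF P'] wt(1)] tight_st_path(3)[OF P'] by simp
  then show "P \<noteq> [] \<and> hd P = source I \<and> last P = target I \<and> successively tight_edge P"
    using wt st by (simp add: st_path_def)
next
  assume P: "P \<noteq> [] \<and> hd P = source I \<and> last P = target I \<and> successively tight_edge P"
  then have "\<not> shorter I P' P" if "st_path I P'" for P'
    using st_path_wt[OF that] tight_st_path(2,3)[of P] shorter_iff[of P' P] by simp
  then show "shortest_st_path I P"
    using P tight_st_path(1)[of P] by (auto simp: shortest_st_path_def)
qed

section \<open>Correctness of the Bellman-Ford tables\<close>

definition weight_val :: "nat set \<Rightarrow> val" where
  "weight_val e = scalar (enc_list enc_nat (ws e)) (flat x Null) Null"

lemma num_weight_val: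
  assumes "e \<in> edges I" shows "num (weight_val e) = wt e"
  unfolding weight_val_def wt_def using bit_length_weight_le[OF assms]
  by (subst num_scalar) (auto simp: size_flat)

lemma the_arcs_entry:
  "a \<in> set (lst (the_arcs x)) \<longleftrightarrow>
     (\<exists>u v. {u, v} \<in> edges I \<and> a = Dot (enc_nat u) (Dot (enc_nat v) (weight_val {u, v})))"
proof -
  let ?arc = "\<lambda>u v. Dot (enc_nat u) (Dot (enc_nat v) (weight_val {u, v}))"
  have arcs: "the_arcs x = arcs (enc_list edge_val es) (flat x Null)"
    unfolding the_arcs_def by (subst x_Dot) simp
  have "head (edge_val p) = enc_nat (fst p)" "head (tail (edge_val p)) = enc_nat (snd p)"
    "scalar (tail (tail (edge_val p))) (flat x Null) Null = weight_val {fst p, snd p}" for p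
    by (simp_all add: edge_val_def weight_val_def case_prod_unfold del: upt_Suc)
  then have "a \<in> set (lst (the_arcs x)) \<longleftrightarrow>
    (\<exists>p\<in>set es. a = ?arc (fst p) (snd p) \<or> a = ?arc (snd p) (fst p))"
    unfolding arcs arcs_entry by (simp add: insert_commute)
  also have "\<dots> \<longleftrightarrow> (\<exists>u v. {u, v} \<in> edges I \<and> a = ?arc u v)"
    by (force simp: edge_iff)
  finally show ?thesis .
qed

lemma bex_the_arcs:
  "(\<exists>a\<in>set (lst (the_arcs x)). Q a) \<longleftrightarrow>
     (\<exists>u v. {u, v} \<in> edges I \<and> Q (Dot (enc_nat u) (Dot (enc_nat v) (weight_val {u, v}))))"
  unfolding Bex_def the_arcs_entry by blast

text \<open>Two one-sided conditions replace minimality, as a table may also hold costs that are not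
  minimal: entries come from walks, and each walk is matched or undercut by an entry.\<close>

definition table_correct :: "nat \<Rightarrow> val \<Rightarrow> bool" where
  "table_correct k T \<longleftrightarrow>
     (\<forall>e\<in>set (lst T). e \<noteq> Null \<and> (\<exists>v. head e = enc_nat v \<and> walk k v (num (tail e)))) \<and>
     (\<forall>v c. walk k v c \<longrightarrow> (\<exists>e\<in>set (lst T). head e = enc_nat v \<and> num (tail e) \<le> c))"

lemma table_correct_step:
  assumes T: "table_correct k T"
  shows "table_correct (Suc k) (Dot (Dot (enc_nat (source I)) Null) (relax (the_arcs x) T))"
    (is "table_correct _ (Dot ?s ?T)")
  unfolding table_correct_def
proof (intro conjI ballI allI impI)
  fix e assume "e \<in> set (lst (Dot ?s ?T))"
  then consider "e = ?s" | "e \<in> set (lst ?T)" by auto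
  then show "e \<noteq> Null" "\<exists>v. head e = enc_nat v \<and> walk (Suc k) v (num (tail e))"
  proof (atomize (full), cases)
    case 2
    then obtain u v where uv: "{u, v} \<in> edges I" "lookup (enc_nat u) T \<noteq> Null"
      and e: "e = Dot (enc_nat v) (add (tail (lookup (enc_nat u) T)) (weight_val {u, v}) Null)"
      by (auto simp: relax_entry the_arcs_entry)
    have "walk k u (num (tail (lookup (enc_nat u) T)))"
      using lookup_in[OF uv(2)] T unfolding table_correct_def by fastforce
    from walk_step[OF this uv(1)] show "e \<noteq> Null \<and> (\<exists>v. head e = enc_nat v \<and> walk (Suc k) v (num (tail e)))"
      using e by (auto simp: num_add num_weight_val[OF uv(1)])
  qed (auto intro: walk_start)
next
  fix v c assume "walk (Suc k) v c"
  then show "\<exists>e\<in>set (lst (Dot ?s ?T)). head e = enc_nat v \<and> num (tail e) \<le> c"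
  proof cases
    case (walk_step u c')
    obtain e where e: "e \<in> set (lst T)" "head e = enc_nat u" "num (tail e) \<le> c'"
      using T walk_step unfolding table_correct_def by blast
    have r: "lookup (enc_nat u) T \<noteq> Null" "num (tail (lookup (enc_nat u) T)) \<le> c'"
      using lookup_min[OF _ e(1,2)] e(3) T by (auto simp: table_correct_def)
    have "Dot (enc_nat v) (add (tail (lookup (enc_nat u) T)) (weight_val {u, v}) Null) \<in> set (lst ?T)"
      unfolding relax_entry
      by (rule bexI[of _ "Dot (enc_nat u) (Dot (enc_nat v) (weight_val {u, v}))"])
        (use r walk_step in \<open>auto simp: the_arcs_entry\<close>)
    then show ?thesis using r walk_step
      by (intro bexI[of _ "Dot (enc_nat v) (add (tail (lookup (enc_nat u) T)) (weight_val {u, v}) Null)"])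
        (auto simp: num_add num_weight_val)
  qed auto
qed

lemma table_correct_dists:
  "table_correct k T \<Longrightarrow>
     table_correct (k + len l) (dists l (the_arcs x) (Dot (enc_nat (source I)) Null) T)"
proof (induction l arbitrary: k T)
  case (Dot b l)
  then show ?case using Dot.IH(2)[OF table_correct_step[OF Dot.prems]] by simp
qed simp

lemma table_correct_the_dists: "table_correct (size x) (the_dists x)"
proof -
  have "walk 0 v c \<longleftrightarrow> v = source I \<and> c = 0" for v c
    by (auto intro: walk_start elim: walk.cases)
  then have "table_correct 0 (Dot (Dot (enc_nat (source I)) Null) Null)"
    by (auto simp: table_correct_def)
  from table_correct_dists[OF this, of "flat x Null"] show ?thesis
    by (simp add: the_dists_def the_source_eq size_flat)
qed

definition dist_val :: "nat \<Rightarrow> val" where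
  "dist_val v = tail (lookup (enc_nat v) (the_dists x))"

lemma lookup_the_dists_iff: "lookup (enc_nat v) (the_dists x) \<noteq> Null \<longleftrightarrow> reachable v"
proof
  assume "lookup (enc_nat v) (the_dists x) \<noteq> Null"
  from lookup_in[OF this] show "reachable v"
    using table_correct_the_dists unfolding table_correct_def reachable_def by fastforce
next
  assume "reachable v"
  then have "walk (size x) v (D v)" using walk_D_bounded card_edges_le by simp
  then obtain e where "e \<in> set (lst (the_dists x))" "head e = enc_nat v"
    using table_correct_the_dists unfolding table_correct_def by blast
  then show "lookup (enc_nat v) (the_dists x) \<noteq> Null"
    using lookup_min table_correct_the_dists unfolding table_correct_def by blast
qed

lemma num_dist_val:
  assumes "reachable v" shows "num (dist_val v) = D v"
proof (rule antisym)
  have "walk (size x) v (D v)" using walk_D_bounded[OF assms] card_edges_le by simp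
  then obtain e where "e \<in> set (lst (the_dists x))" "head e = enc_nat v" "num (tail e) \<le> D v"
    using table_correct_the_dists unfolding table_correct_def by blast
  then show "num (dist_val v) \<le> D v"
    using lookup_min[of "the_dists x" e "enc_nat v"] table_correct_the_dists
    unfolding table_correct_def dist_val_def by auto
  show "D v \<le> num (dist_val v)"
    using lookup_in[of "enc_nat v" "the_dists x"] assms lookup_the_dists_iff table_correct_the_dists D_le
    unfolding table_correct_def dist_val_def by (metis enc_nat_inject)
qed

text \<open>The distance is the very tree found in the table, possibly with leading zeros, and
  depends on \<open>v\<close> alone. So equal arcs have identical tokens, and structural equality of
  trees decides equality of arcs.\<close>

definition token :: "nat \<Rightarrow> nat \<Rightarrow> val" where
  "token u v = Dot (enc_nat v) (Dot (enc_nat u) (dist_val v))"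

lemma the_tokens_entry: "b \<in> set (lst (the_tokens x)) \<longleftrightarrow> (\<exists>u v. tight_edge u v \<and> b = token u v)"
proof -
  have "b \<in> set (lst (the_tokens x)) \<longleftrightarrow>
    (\<exists>u v. {u, v} \<in> edges I \<and> reachable u \<and>
       num (dist_val u) + num (weight_val {u, v}) \<le> num (dist_val v) \<and> b = token u v)"
    by (simp add: the_tokens_def tight_entry bex_the_arcs token_def dist_val_def
        lookup_the_dists_iff)
  moreover have "num (dist_val u) + num (weight_val {u, v}) \<le> num (dist_val v) \<longleftrightarrow>
      D u + wt {u, v} \<le> D v" if "{u, v} \<in> edges I" "reachable u" for u v
    using that reachable_step[OF that(2,1)] by (simp add: num_dist_val num_weight_val)
  ultimately show ?thesis unfolding tight_edge_def by blast
qed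

lemma rank_token: "tight_edge u v \<Longrightarrow> rank (token u v) = D v"
  using num_dist_val[of v] reachable_step[of u v] by (simp add: token_def tight_edge_def)

end


section \<open>The search for disjoint paths\<close>

lemma head_eq_hd: "lst P \<noteq> [] \<Longrightarrow> head P = hd (lst P)"
  by (cases P) auto

lemma lst_revheads: "lst (revheads P acc) = rev (map head (lst P)) @ lst acc"
  by (induction P arbitrary: acc) auto

lemma search_funpow: "search l K i S = ((\<lambda>S. Dot i (move K S)) ^^ len l) S"
  by (induction l arbitrary: S) (simp_all add: funpow_Suc_right del: funpow.simps)

lemma pick_neq_Null:
  "\<forall>e\<in>set (lst S). e \<noteq> Null \<Longrightarrow> e \<in> set (lst S) \<Longrightarrow> extends a b e \<Longrightarrow> pick a b S \<noteq> Null"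
  by (induction S) auto

lemma finish_cases:
  "finish S t = Null \<and> (\<forall>e\<in>set (lst S). \<not> final t e) \<or>
   (\<exists>e\<in>set (lst S). final t e \<and>
     finish S t = Dot Null (Dot (revheads (head e) Null) (revheads (tail e) Null)))"
  by (induction S) auto

lemma compatible_sym: "compatible t fl a b \<longleftrightarrow> compatible t fl b a"
  by (auto simp: compatible_def)

lemma path_edges_rev: "path_edges (rev P) = path_edges P"
proof (induction P)
  case IH: (Cons v P)
  show ?case
  proof (cases P)
    case (Cons a Q)
    then have "path_edges (rev P @ [v]) = insert {a, v} (path_edges (rev P))"
      by (subst path_edges_snoc) (auto simp: last_rev)
    then show ?thesis using IH.IH Cons by (simp add: insert_commute)
  qed simp
qed simp

lemma mono_time_bound: "mono time_bound"
  unfolding time_bound_def[abs_def] bound_defs by (intro monoI add_mono mult_mono) auto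

section \<open>Partial paths and their tokens\<close>

context encoded_instance
begin

text \<open>Paths are built backwards, so a partial path is the list of its nodes down to the source.\<close>

definition back_path :: "nat list \<Rightarrow> bool" where
  "back_path ns \<longleftrightarrow> ns \<noteq> [] \<and> last ns = source I \<and> successively (\<lambda>v u. tight_edge u v) ns"

fun tokens :: "nat list \<Rightarrow> val list" where
  "tokens [] = []"
| "tokens [v] = [start_token x]"
| "tokens (v # u # ns) = token u v # tokens (u # ns)"

text \<open>The start token is left out: it occurs in every partial path and must not count as a
  conflict.\<close>

fun arc_tokens :: "nat list \<Rightarrow> val set" where
  "arc_tokens [] = {}"
| "arc_tokens [v] = {}"
| "arc_tokens (v # u # ns) = insert (token u v) (arc_tokens (u # ns))"

lemma back_path_singleton: "back_path [v] \<longleftrightarrow> v = source I"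
  by (simp add: back_path_def)

lemma back_path_Cons:
  "back_path (v # u # ns) \<longleftrightarrow> tight_edge u v \<and> back_path (u # ns)"
  by (auto simp: back_path_def)

lemma back_path_induct [consumes 1, case_names source step]:
  assumes "back_path ns" "Q [source I]"
    "\<And>u v ns. tight_edge u v \<Longrightarrow> back_path (u # ns) \<Longrightarrow> Q (u # ns) \<Longrightarrow> Q (v # u # ns)"
  shows "Q ns"
  using assms(1)
proof (induction ns rule: induct_list012)
  case 1
  then show ?case by (simp add: back_path_def)
next
  case (2 v)
  then show ?case using assms(2) by (simp add: back_path_singleton)
next
  case (3 v u ns)
  then show ?case using assms(3) by (simp add: back_path_Cons)
qed

lemma back_path_iff_shortest:
  "back_path ns \<and> hd ns = target I \<longleftrightarrow> shortest_st_path I (rev ns)"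
  by (auto simp: back_path_def shortest_iff_tight hd_rev last_rev successively_rev)

lemma back_path_length: "back_path ns \<Longrightarrow> length ns \<le> 1 + 2 * card (edges I)"
  using tight_path_length[of "rev ns"] by (simp add: back_path_def successively_rev)

lemma back_path_D:
  assumes "back_path ns" shows "\<forall>w\<in>set (tl ns). D w < D (hd ns)"
  using assms
proof (induction rule: back_path_induct)
  case (step u v ns)
  then show ?case using tight_edge_less[of u v] by (auto intro: less_trans)
qed simp

lemma back_path_D_le: "back_path ns \<Longrightarrow> w \<in> set ns \<Longrightarrow> D w \<le> D (hd ns)"
  using back_path_D[of ns] by (cases ns) (auto simp: less_imp_le)

lemma back_path_hd_source: "back_path ns \<Longrightarrow> hd ns = source I \<Longrightarrow> ns = [source I]"
  by (induction rule: back_path_induct) (auto dest: tight_edge_less)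

lemma token_inject [simp]: "token u v = token u' v' \<longleftrightarrow> u = u' \<and> v = v'"
  by (auto simp: token_def)

lemma head_token [simp]: "head (token u v) = enc_nat v" "head (tail (token u v)) = enc_nat u"
  by (simp_all add: token_def)

lemma head_start_token [simp]: "head (start_token x) = enc_nat (source I)"
  by (simp add: start_token_def the_source_eq)

lemma tokens_Nil_iff [simp]: "tokens ns = [] \<longleftrightarrow> ns = []"
  by (cases ns rule: tokens.cases) auto

lemma hd_tokens:
  assumes "back_path ns"
  shows "head (hd (tokens ns)) = enc_nat (hd ns)" "rank (hd (tokens ns)) = D (hd ns)"
    "hd (tokens ns) = start_token x \<and> ns = [source I] \<or>
     hd (tokens ns) \<in> arc_tokens ns \<and> hd (tokens ns) \<in> set (lst (the_tokens x))"
  using assms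
  by (induction rule: back_path_induct)
    (auto simp: rank_token the_tokens_entry, simp_all add: start_token_def)

lemma map_head_tokens: "back_path ns \<Longrightarrow> map head (tokens ns) = map enc_nat ns"
  by (induction rule: back_path_induct) auto

lemma arc_tokensD:
  assumes "back_path ns" "a \<in> arc_tokens ns"
  obtains u v where "a = token u v" "tight_edge u v" "{u, v} \<in> path_edges ns" "u \<in> set ns" "v \<in> set ns"
    "a = hd (tokens ns) \<or> v \<in> set (tl ns)"
proof -
  have "\<exists>u v. a = token u v \<and> tight_edge u v \<and> {u, v} \<in> path_edges ns \<and> u \<in> set ns \<and> v \<in> set ns \<and>
    (a = hd (tokens ns) \<or> v \<in> set (tl ns))"
    using assms
  proof (induction rule: back_path_induct)
    case (step u v ns)
    then show ?case by (auto simp: insert_commute)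
  qed simp
  with that show ?thesis by blast
qed

lemma path_edges_arc_tokens:
  assumes "back_path ns" "e \<in> path_edges ns"
  obtains u v where "e = {u, v}" "tight_edge u v" "token u v \<in> arc_tokens ns"
proof -
  have "\<exists>u v. e = {u, v} \<and> tight_edge u v \<and> token u v \<in> arc_tokens ns"
    using assms by (induction rule: back_path_induct) (auto simp: insert_commute)
  with that show ?thesis by blast
qed

lemma node_arc_tokens:
  assumes "back_path ns" "v \<in> set ns" "v \<noteq> source I"
  obtains u where "token u v \<in> arc_tokens ns"
proof -
  have "\<exists>u. token u v \<in> arc_tokens ns"
    using assms by (induction rule: back_path_induct) auto
  with that show ?thesis by blast
qed

section \<open>The invariant of the search\<close>

definition compat :: "val \<Rightarrow> nat list \<Rightarrow> nat list \<Rightarrow> bool" where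
  "compat fl ns ms \<longleftrightarrow> (\<forall>a\<in>arc_tokens ns. \<forall>b\<in>arc_tokens ms. compatible (the_target x) fl a b)"

text \<open>
  The invariant of always extending the path whose end is closer to the source. It implies that the
  next arc can only conflict with the last arc of the other path.
\<close>

definition interleaved :: "nat list \<Rightarrow> nat list \<Rightarrow> bool" where
  "interleaved ns ms \<longleftrightarrow> (\<forall>v\<in>set (tl ns). D v \<le> D (hd ms))"

definition pair_ok :: "val \<Rightarrow> nat list \<Rightarrow> nat list \<Rightarrow> bool" where
  "pair_ok fl ns ms \<longleftrightarrow> back_path ns \<and> back_path ms \<and> compat fl ns ms \<and>
     interleaved ns ms \<and> interleaved ms ns"

lemma pair_ok_sym: "pair_ok fl ns ms \<Longrightarrow> pair_ok fl ms ns"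
  unfolding pair_ok_def compat_def using compatible_sym by blast

definition state_ok :: "val \<Rightarrow> val \<Rightarrow> bool" where
  "state_ok fl S \<longleftrightarrow> S \<noteq> Null \<and>
     (\<exists>ns ms. pair_ok fl ns ms \<and> lst (head S) = tokens ns \<and> lst (tail S) = tokens ms)"

lemma pair_ok_extend:
  assumes ok: "pair_ok fl ns ms" and tight: "tight_edge (hd ns) v" and le: "D (hd ns) \<le> D (hd ms)"
    and comp: "compatible (the_target x) fl (token (hd ns) v) (hd (tokens ms))"
  shows "pair_ok fl (v # ns) ms"
proof -
  obtain u r where ns: "ns = u # r" using ok by (cases ns) (auto simp: pair_ok_def back_path_def)
  note ok' = ok[unfolded pair_ok_def]
  have "compatible (the_target x) fl (token u v) b" if b: "b \<in> arc_tokens ms" for b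
  proof -
    obtain u' v' where uv: "b = token u' v'" "b = hd (tokens ms) \<or> v' \<in> set (tl ms)"
      using b ok' by (metis arc_tokensD)
    from uv(2) show ?thesis
    proof
      \<comment> \<open>An earlier arc of \<open>ms\<close> ends no farther than \<open>u\<close>,
        hence strictly nearer than \<open>v\<close>. It enters another node and is compatible in
        both versions.\<close>
      assume "v' \<in> set (tl ms)"
      then have "D v' \<le> D u" using ok' ns by (auto simp: interleaved_def)
      then have "v' \<noteq> v" using tight_edge_less tight ns by fastforce
      then show ?thesis using uv(1) by (simp add: compatible_def)
    qed (use comp ns in simp)
  qed
  moreover have "interleaved (v # ns) ms" using ok' le ns by (auto simp: interleaved_def)
  moreover have "interleaved ms (v # ns)"
    using ok' tight_edge_less[OF tight] ns unfolding interleaved_def by fastforce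
  moreover have "back_path (v # ns)" using ok' tight ns by (simp add: back_path_Cons)
  ultimately show ?thesis using ok' ns by (auto simp: pair_ok_def compat_def)
qed

lemma the_keys_entry:
  "k \<in> set (lst (the_keys fl x)) \<longleftrightarrow> (\<exists>u v b. k = Dot (token u v) b \<and> tight_edge u v \<and>
     (b = start_token x \<or> b \<in> set (lst (the_tokens x))) \<and> compatible (the_target x) fl (token u v) b)"
  unfolding the_keys_def keys_entry by (auto simp: the_tokens_entry)

lemma state_ok_start: "state_ok fl (start_state x)"
proof -
  have "pair_ok fl [source I] [source I]"
    by (simp add: pair_ok_def back_path_singleton compat_def interleaved_def)
  then show ?thesis unfolding state_ok_def start_state_def by force
qed

lemma state_ok_move:
  assumes S: "\<forall>e\<in>set (lst S). state_ok fl e" and e: "e \<in> set (lst (move (the_keys fl x) S))"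
  shows "state_ok fl e"
proof -
  obtain k r where k: "k \<in> set (lst (the_keys fl x))" and r: "r \<in> set (lst S)" "extends (head k) (tail k) r"
    and e: "e = Dot (Dot (head k) (head r)) (tail r) \<or> e = Dot (tail r) (Dot (head k) (head r))"
    using e unfolding move_entry using pick_in by blast
  obtain u v b where uv: "k = Dot (token u v) b" "tight_edge u v"
    "compatible (the_target x) fl (token u v) b"
    using k by (auto simp: the_keys_entry)
  obtain ns ms where ok: "pair_ok fl ns ms" and lst: "lst (head r) = tokens ns" "lst (tail r) = tokens ms"
    using S r(1) by (auto simp: state_ok_def)
  have path: "back_path ns" "back_path ms" using ok by (auto simp: pair_ok_def)
  then have ne: "ns \<noteq> []" "ms \<noteq> []" by (auto simp: back_path_def)
  have hds: "head (head r) = hd (tokens ns)" "head (tail r) = hd (tokens ms)"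
    using lst ne by (simp_all add: head_eq_hd)
  have "b = hd (tokens ms)" "u = hd ns" "D (hd ns) \<le> D (hd ms)"
    using r(2) uv(1) hds hd_tokens[OF path(1)] hd_tokens[OF path(2)] by (auto simp: extends_def)
  then have "pair_ok fl (v # ns) ms" using pair_ok_extend[OF ok] uv by simp
  moreover have "tokens (v # ns) = token u v # tokens ns"
    using ne(1) \<open>u = hd ns\<close> by (cases ns) auto
  ultimately show ?thesis
    using e uv(1) lst pair_ok_sym unfolding state_ok_def by force
qed

section \<open>Soundness and completeness of the states after \<open>k\<close> rounds\<close>

definition states :: "val \<Rightarrow> nat \<Rightarrow> val" where
  "states fl k = ((\<lambda>S. Dot (start_state x) (move (the_keys fl x) S)) ^^ k) (Dot (start_state x) Null)"

lemma states_Suc: "states fl (Suc k) = Dot (start_state x) (move (the_keys fl x) (states fl k))"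
  by (simp add: states_def)

lemma the_states_eq: "the_states fl x = states fl (2 * size x)"
  by (simp add: the_states_def states_def search_funpow size_flat mult_2)

lemma start_in_states: "start_state x \<in> set (lst (states fl k))"
  by (cases k) (simp_all add: states_Suc, simp add: states_def)

lemma state_ok_states: "\<forall>e\<in>set (lst (states fl k)). state_ok fl e"
proof (induction k)
  case 0
  then show ?case using state_ok_start by (simp add: states_def)
next
  case (Suc k)
  then show ?case using state_ok_start state_ok_move by (auto simp: states_Suc)
qed

text \<open>The pair itself may have been superseded by another one with the same last tokens, so
  coverage asks only for a representative.\<close>

definition covered :: "val \<Rightarrow> nat \<Rightarrow> nat list \<Rightarrow> nat list \<Rightarrow> bool" where
  "covered fl k ns ms \<longleftrightarrow> (\<exists>e\<in>set (lst (states fl k)).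
     head (head e) = hd (tokens ns) \<and> head (tail e) = hd (tokens ms))"

text \<open>The state picked may differ from the witness \<open>e\<close> and may even reach
  \<open>u\<close> by another arc. Any choice works, since after the move the last token of the
  extended path is \<open>token u v\<close>.\<close>

lemma covered_step:
  assumes ok: "pair_ok fl (v # u # ns) ms" and cov: "covered fl k (u # ns) ms"
  shows "covered fl (Suc k) (v # u # ns) ms" "covered fl (Suc k) ms (v # u # ns)"
proof -
  have path: "back_path (v # u # ns)" "back_path (u # ns)" "back_path ms" and tight: "tight_edge u v"
    using ok by (auto simp: pair_ok_def back_path_Cons)
  let ?a = "token u v" and ?b = "hd (tokens ms)"
  let ?r = "pick ?a ?b (states fl k)"
  obtain e where e: "e \<in> set (lst (states fl k))"
    "head (head e) = hd (tokens (u # ns))" "head (tail e) = ?b"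
    using cov by (auto simp: covered_def)
  have "D u \<le> D (hd ms)" using ok by (auto simp: pair_ok_def interleaved_def)
  then have "extends ?a ?b e"
    using e hd_tokens[OF path(2)] hd_tokens[OF path(3)] by (auto simp: extends_def)
  then have r: "?r \<noteq> Null"
    using pick_neq_Null e(1) state_ok_states unfolding state_ok_def by blast
  have "compatible (the_target x) fl ?a ?b"
    using hd_tokens(3)[OF path(3)]
  proof
    assume "?b = start_token x \<and> ms = [source I]"
    \<comment> \<open>No tight arc enters the source, whose distance is 0, so the start token
      conflicts with no arc.\<close>
    moreover have "v \<noteq> source I" using tight_edge_less[OF tight] by auto
    ultimately show ?thesis by (auto simp: compatible_def) (metis enc_nat_inject head_start_token head_token(1))
  qed (use ok in \<open>auto simp: pair_ok_def compat_def\<close>)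
  then have key: "Dot ?a ?b \<in> set (lst (the_keys fl x))"
    using tight hd_tokens(3)[OF path(3)] by (auto simp: the_keys_entry)
  have heads: "head (tail ?r) = ?b" using pick_in[OF r] by (simp add: extends_def)
  have "Dot (Dot ?a (head ?r)) (tail ?r) \<in> set (lst (states fl (Suc k)))"
    "Dot (tail ?r) (Dot ?a (head ?r)) \<in> set (lst (states fl (Suc k)))"
    using key r unfolding states_Suc by (auto simp: move_entry intro!: bexI[of _ "Dot ?a ?b"])
  with heads show "covered fl (Suc k) (v # u # ns) ms" "covered fl (Suc k) ms (v # u # ns)"
    unfolding covered_def by (auto intro: bexI[rotated])
qed

text \<open>Dropping the last arc can only break \<open>interleaved ms (u # ns)\<close>, and
  \<open>le\<close> is exactly this.\<close>

lemma pair_ok_predecessor: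
  assumes ok: "pair_ok fl (v # u # ns) ms" and le: "\<forall>w\<in>set (tl ms). D w \<le> D u"
  shows "pair_ok fl (u # ns) ms"
  using ok le by (auto simp: pair_ok_def back_path_Cons compat_def interleaved_def)

text \<open>
  Undoing the last move: of the two partial paths, the one whose second node is farther from the
  source was extended last.
\<close>

lemma covered_if_pair_ok:
  "pair_ok fl ns ms \<Longrightarrow> length ns + length ms \<le> k + 2 \<Longrightarrow> covered fl k ns ms \<and> covered fl k ms ns"
proof (induction k arbitrary: ns ms)
  case 0
  then have "length ns = 1" "length ms = 1"
    by (cases ns; cases ms; auto simp: pair_ok_def back_path_def)+
  then have "tokens ns = [start_token x]" "tokens ms = [start_token x]"
    by (auto simp: length_Suc_conv)
  then show ?case using start_in_states[of fl 0]
    by (auto simp: covered_def start_state_def intro!: bexI[of _ "start_state x"])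
next
  case (Suc k)
  have undo: "covered fl (Suc k) ns ms \<and> covered fl (Suc k) ms ns"
    if "pair_ok fl ns ms" "length ns + length ms \<le> Suc k + 2" "ns = v # u # r"
      "\<forall>w\<in>set (tl ms). D w \<le> D u" for ns ms v u r
    using that covered_step[of fl v u r ms k] Suc.IH[of "u # r" ms] pair_ok_predecessor[of fl v u r ms]
    by auto
  have path: "back_path ns" "back_path ms" using Suc.prems(1) by (auto simp: pair_ok_def)
  consider "ns = [source I]" "ms = [source I]"
    | v u r where "ns = v # u # r" "\<forall>w\<in>set (tl ms). D w \<le> D u"
    | v u r where "ms = v # u # r" "\<forall>w\<in>set (tl ns). D w \<le> D u"
  proof (cases ns rule: tokens.cases; cases ms rule: tokens.cases)
    fix v u r v' u' r' assume *: "ns = v # u # r" "ms = v' # u' # r'"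
    then have "back_path (u # r)" "back_path (u' # r')" using path by (auto simp: back_path_Cons)
    then have "\<forall>w\<in>set (u # r). D w \<le> D u" "\<forall>w\<in>set (u' # r'). D w \<le> D u'"
      using back_path_D_le by fastforce+
    then have "(\<forall>w\<in>set (tl ms). D w \<le> D u) \<or> (\<forall>w\<in>set (tl ns). D w \<le> D u')"
      using * by (cases "D u \<le> D u'") fastforce+
    then show thesis using that(2)[of v u r] that(3)[of v' u' r'] * by blast
  qed (use path that in \<open>auto simp: back_path_def\<close>)
  then show ?case
  proof cases
    case 1
    then show ?thesis using start_in_states[of fl "Suc k"]
      by (auto simp: covered_def start_state_def intro!: bexI[of _ "start_state x"])
  next
    case 2
    then show ?thesis using undo Suc.prems by blast
  next
    case 3
    then show ?thesis using undo[of ms ns] Suc.prems pair_ok_sym by (simp add: add.commute)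
  qed
qed

section \<open>Solutions as compatible pairs of paths to the target\<close>

definition solution :: "val \<Rightarrow> nat list \<times> nat list \<Rightarrow> bool" where
  "solution fl = (if fl = Null then node_disjoint_solution I else edge_disjoint_solution I)"

lemma compat_imp_solution:
  assumes path: "back_path ns" "back_path ms" and hd: "hd ns = target I" "hd ms = target I"
    and ne: "hd (tokens ns) \<noteq> hd (tokens ms)" and compat: "compat fl ns ms"
  shows "solution fl (rev ns, rev ms)"
proof -
  have short: "shortest_st_path I (rev ns)" "shortest_st_path I (rev ms)"
    using back_path_iff_shortest path hd by blast+
  have neq: "rev ns \<noteq> rev ms" using ne by auto
  have edges: "path_edges (rev ns) \<inter> path_edges (rev ms) = {}"
  proof (rule ccontr)
    assume "\<not> ?thesis"
    then obtain e where "e \<in> path_edges ns" "e \<in> path_edges ms" by (auto simp: path_edges_rev)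
    then obtain u v u' v' where uv: "{u, v} = {u', v'}" "tight_edge u v" "tight_edge u' v'"
      "token u v \<in> arc_tokens ns" "token u' v' \<in> arc_tokens ms"
      using path by (metis path_edges_arc_tokens)
    \<comment> \<open>\<open>D\<close> increases along tight edges, so both paths traverse a common
      edge in the same direction and share its token.\<close>
    then have "u = u' \<and> v = v'"
      using tight_edge_less[of u v] tight_edge_less[of u' v'] by (auto simp: doubleton_eq_iff)
    then show False using uv compat by (auto simp: compat_def compatible_def)
  qed
  have nodes: "set (rev ns) \<inter> set (rev ms) = {source I, target I}" if "fl = Null"
  proof
    have "w = target I" if w: "w \<in> set ns" "w \<in> set ms" "w \<noteq> source I" for w
    proof -
      obtain u u' where "token u w \<in> arc_tokens ns" "token u' w \<in> arc_tokens ms"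
        using path w by (metis node_arc_tokens)
      then have "compatible (the_target x) fl (token u w) (token u' w)"
        using compat by (auto simp: compat_def)
      then show ?thesis using \<open>fl = Null\<close> by (simp add: compatible_def the_target_eq)
    qed
    then show "set (rev ns) \<inter> set (rev ms) \<subseteq> {source I, target I}" by auto
    show "{source I, target I} \<subseteq> set (rev ns) \<inter> set (rev ms)"
      using path hd by (auto simp: back_path_def) (metis hd_in_set last_in_set)+
  qed
  show ?thesis using short neq edges nodes
    by (simp add: solution_def node_disjoint_solution_def edge_disjoint_solution_def)
qed

text \<open>The target is the farthest node of such a path, so an arc into it is the last one, and
  only the trivial path ends at the source. This handles the direct edge, the one common arc that
  sharing no inner nodes does not exclude.\<close>

lemma back_path_source_target:
  assumes "back_path ns" "hd ns = target I" "token (source I) (target I) \<in> arc_tokens ns"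
  shows "ns = [target I, source I]"
proof (cases ns rule: tokens.cases)
  case (3 v u r)
  have path: "back_path (u # r)" "tight_edge u (target I)" using assms 3 by (auto simp: back_path_Cons)
  have "token (source I) (target I) \<notin> arc_tokens (u # r)"
  proof
    assume "token (source I) (target I) \<in> arc_tokens (u # r)"
    then have "target I \<in> set (u # r)" using path(1) by (auto elim!: arc_tokensD)
    then have "D (target I) \<le> D u" using back_path_D_le[OF path(1)] by fastforce
    then show False using tight_edge_less[OF path(2)] by simp
  qed
  then have "u = source I" using assms 3 by auto
  then show ?thesis using back_path_hd_source[OF path(1)] assms(2) 3 by simp
qed (use assms in auto)

lemma solution_imp_compat:
  assumes sol: "solution fl (rev ns, rev ms)"
  shows "pair_ok fl ns ms" "hd (tokens ns) \<noteq> hd (tokens ms)" "hd ns = target I" "hd ms = target I"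
proof -
  have sol': "shortest_st_path I (rev ns)" "shortest_st_path I (rev ms)" "ns \<noteq> ms"
    using sol by (auto simp: solution_def node_disjoint_solution_def edge_disjoint_solution_def
      split: if_splits)
  then have path: "back_path ns" "back_path ms" and hd: "hd ns = target I" "hd ms = target I"
    using back_path_iff_shortest by blast+
  show "hd ns = target I" "hd ms = target I" by fact+
  have ne: "source I \<noteq> target I" using back_path_hd_source path hd sol'(3) by metis
  have "compatible (the_target x) fl a b" if ab: "a \<in> arc_tokens ns" "b \<in> arc_tokens ms" for a b
  proof -
    obtain u v where a: "a = token u v" "tight_edge u v" "{u, v} \<in> path_edges ns" "u \<in> set ns" "v \<in> set ns"
      using arc_tokensD[OF path(1) ab(1)] by metis
    obtain u' v' where b: "b = token u' v'" "{u', v'} \<in> path_edges ms" "u' \<in> set ms" "v' \<in> set ms"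
      using arc_tokensD[OF path(2) ab(2)] by metis
    have D: "D u < D v" using tight_edge_less[OF a(2)] .
    show ?thesis
    proof (cases "fl = Null")
      case False
      then have "path_edges ns \<inter> path_edges ms = {}"
        using sol by (simp add: solution_def edge_disjoint_solution_def path_edges_rev)
      then show ?thesis using a b False by (auto simp: compatible_def)
    next
      case True
      then have int: "set ns \<inter> set ms = {source I, target I}"
        using sol by (simp add: solution_def node_disjoint_solution_def)
      have v: "v = target I" if "v = v'"
      proof -
        have "v \<in> {source I, target I}" using int a b that by blast
        then show ?thesis using D by auto
      qed
      have "a \<noteq> b"
      proof
        assume eq: "a = b"
        then have "u \<in> {source I, target I}" "v = target I" using int a b v by auto
        then have "u = source I" using D by auto
        then have "a = token (source I) (target I)" using a \<open>v = target I\<close> by simp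
        then show False
          using back_path_source_target[OF path(1) hd(1)] back_path_source_target[OF path(2) hd(2)]
            ab eq sol'(3) by simp
      qed
      then show ?thesis using a b v by (auto simp: compatible_def the_target_eq)
    qed
  qed
  then have comp: "compat fl ns ms" by (simp add: compat_def)
  \<comment> \<open>Both paths end at the target, which is farther than all their other nodes. So
    every finished pair satisfies the invariant.\<close>
  have "interleaved ns ms" "interleaved ms ns"
    using back_path_D[OF path(1)] back_path_D[OF path(2)] hd
    by (auto simp: interleaved_def less_imp_le)
  then show "pair_ok fl ns ms" using path comp by (simp add: pair_ok_def)
  have "ns \<noteq> [source I]" "ms \<noteq> [source I]" using hd ne by auto
  then have "hd (tokens ns) \<in> arc_tokens ns" "hd (tokens ms) \<in> arc_tokens ms"
    using hd_tokens(3) path by blast+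
  then show "hd (tokens ns) \<noteq> hd (tokens ms)" using comp by (auto simp: compat_def compatible_def)
qed

theorem main_correct: "\<exists>ans. main fl x = enc_solution ans \<and> correct_answer (\<lambda>_. solution fl) I ans"
proof -
  let ?S = "the_states fl x"
  have t: "the_target x = enc_nat (target I)" by (rule the_target_eq)
  from finish_cases[of ?S "the_target x"] show ?thesis
  proof
    assume none: "finish ?S (the_target x) = Null \<and> (\<forall>e\<in>set (lst ?S). \<not> final (the_target x) e)"
    have "\<not> solution fl z" for z
    proof
      assume "solution fl z"
      then obtain ns ms where sol: "solution fl (rev ns, rev ms)"
        by (metis prod.collapse rev_rev_ident)
      note ok = solution_imp_compat[OF sol]
      have path: "back_path ns" "back_path ms" using ok(1) by (auto simp: pair_ok_def)
      \<comment> \<open>Each path has at most \<open>1 + 2 * card (edges I)\<close> nodes, hence at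
        most \<open>size x\<close> arcs. A round adds one arc to one of the two paths, which is why
        the search runs for twice the clock.\<close>
      have "length ns + length ms \<le> 2 * size x + 2"
        using back_path_length[OF path(1)] back_path_length[OF path(2)] card_edges_le by simp
      then have "covered fl (2 * size x) ns ms" using covered_if_pair_ok[OF ok(1)] by simp
      then obtain e where "e \<in> set (lst ?S)" "head (head e) = hd (tokens ns)"
        "head (tail e) = hd (tokens ms)"
        by (auto simp: covered_def the_states_eq)
      moreover from this have "final (the_target x) e"
        using ok hd_tokens(1) path by (simp add: final_def t)
      ultimately show False using none by blast
    qed
    then show ?thesis using none
      by (intro exI[of _ None]) (simp add: main_def enc_solution_def correct_answer_def)
  next
    assume "\<exists>e\<in>set (lst ?S). final (the_target x) e \<and>
      finish ?S (the_target x) = Dot Null (Dot (revheads (head e) Null) (revheads (tail e) Null))"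
    then obtain e where e: "e \<in> set (lst ?S)" "final (the_target x) e"
      and main: "main fl x = Dot Null (Dot (revheads (head e) Null) (revheads (tail e) Null))"
      by (auto simp: main_def)
    obtain ns ms where ok: "pair_ok fl ns ms"
      and lst: "lst (head e) = tokens ns" "lst (tail e) = tokens ms"
      using e(1) state_ok_states unfolding the_states_eq state_ok_def by blast
    have path: "back_path ns" "back_path ms" and "compat fl ns ms" using ok by (auto simp: pair_ok_def)
    have hds: "head (head e) = hd (tokens ns)" "head (tail e) = hd (tokens ms)"
      using lst path by (simp_all add: head_eq_hd back_path_def)
    then have "hd ns = target I" "hd ms = target I" "hd (tokens ns) \<noteq> hd (tokens ms)"
      using e(2) hd_tokens(1)[OF path(1)] hd_tokens(1)[OF path(2)] by (auto simp: final_def t)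
    then have "solution fl (rev ns, rev ms)"
      using compat_imp_solution path \<open>compat fl ns ms\<close> by blast
    moreover have "revheads P Null = enc_list enc_nat (rev ks)"
      if "lst P = tokens ks" "back_path ks" for P ks
      by (rule lst_inj) (simp add: lst_revheads that map_head_tokens rev_map)
    then have "main fl x = enc_solution (Some (rev ns, rev ms))"
      using main lst path by (simp add: enc_solution_def enc_pair_def)
    ultimately show ?thesis by (intro exI[of _ "Some (rev ns, rev ms)"]) (simp add: correct_answer_def)
  qed
qed

end

section \<open>Polynomial running time of both versions\<close>

theorem poly_time_solvable_disjoint:
  assumes "fl = NullE \<and> fl' = Null \<and> sol = node_disjoint_solution \<or>
           fl = TrueE \<and> fl' = TT \<and> sol = edge_disjoint_solution"
  shows "poly_time_solvable valid_instance encodes_instance instance_size enc_solution sol"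
proof -
  \<comment> \<open>The argument of \<open>time_bound\<close> is the bound on the input size from
    \<open>size_x_le\<close>, and the final 2 pays for the entry call.\<close>
  have "poly_bounded (\<lambda>M. time_bound (4 + 8 * M + M * (3 + 5 * M) + 2 * M) + 2)"
    by (intro poly_bounded_add poly_bounded_comp[OF poly_bounded_time_bound] poly_bounded_intros)
  then obtain p :: "nat poly" where
    p: "time_bound (4 + 8 * M + M * (3 + 5 * M) + 2 * M) + 2 \<le> poly p M" for M
    by (auto simp: poly_bounded_def)
  have "\<exists>ans k. runs (prog fl) x (enc_solution ans) k \<and> k \<le> poly p (instance_size I) \<and>
      correct_answer sol I ans"
    if inst: "valid_instance I" "encodes_instance I x" for I x
  proof -
    obtain n es where "encoded_instance I n es x"
      using inst unfolding encodes_instance_def encoded_instance_def by blast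
    then interpret encoded_instance I n es x .
    obtain ans where ans: "main fl' x = enc_solution ans" "correct_answer (\<lambda>_. solution fl') I ans"
      using main_correct by blast
    obtain k where k: "k \<le> main_cost fl' x + 2" "runs (prog fl) x (main fl' x) k"
      using runs_prog[of fl fl' x] assms by auto
    have "main_cost fl' x \<le> time_bound (size x)" by (rule main_cost_le)
    also have "\<dots> \<le> time_bound (4 + 8 * instance_size I + instance_size I * (3 + 5 * instance_size I)
        + 2 * instance_size I)"
      by (rule monoD[OF mono_time_bound size_x_le])
    finally have "k \<le> poly p (instance_size I)" using k(1) p[of "instance_size I"] by linarith
    moreover have "correct_answer sol I ans"
      using ans(2) assms by (auto simp: correct_answer_def solution_def split: option.splits)
    ultimately show ?thesis using k(2) ans(1) by metis
  qed
  then show ?thesis unfolding poly_time_solvable_def by blast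
qed

theorem theorem2:
  shows "poly_time_solvable valid_instance encodes_instance instance_size enc_solution
           node_disjoint_solution \<and>
         poly_time_solvable valid_instance encodes_instance instance_size enc_solution
           edge_disjoint_solution"
  using poly_time_solvable_disjoint by blast

end
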